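(* Let $m\ge 2$. The restriction of the extended first Johnson homomorphism to the braid group $B_m$ satisfies \[ \tau_1^{\theta}=\delta\circ C:\ B_m\to \mathrm{Hom}(H,\wedge^2 H). \] In other words, for each $\beta\in B_m$ and each $i\in\{1,\dots,m\}$, we have $\tau_1^{\theta}(\beta)(X_i)=X_i\wedge f_i(\beta)$.
   Context: Braids. $B_m$ is the braid group with standard generators $\sigma_1,\dots,\sigma_{m-1}$ (relations $\sigma_i\sigma_j\sigma_i=\sigma_j\sigma_i\sigma_j$ for $|i-j|=1$, $\sigma_i\sigma_j=\sigma_j\sigma_i$ for $|i-j|>1$). Braids are drawn with starting points at the top and terminal points at the bottom; $\beta_1\beta_2$ is $\beta_1$ stacked above $\beta_2$. The $i$-th string is the one starting at position $i$ at the top. The generator $\sigma_i$ has one crossing, in which the string from top position $i+1$ to bottom position $i$ passes over the string from top position $i$ to bottom position $i+1$. A crossing is positive if its over-strand runs from upper right to lower left (as in $\sigma_i$), and negative if its over-strand runs from upper left to lower right (as in $\sigma_i^{-1}$). Crossing matrix. $\mathrm{Mat}_m^0$ is the additive group of $m\times m$ integer matrices with zero diagonal. For $\beta\in B_m$, $C(\beta)\in\mathrm{Mat}_m^0$ is the matrix whose $(i,j)$ entry is the algebraic number (positive crossings count $+1$, negative ones $-1$) of crossings, in any diagram of $\beta$, between the $i$-th and $j$-th strings of $\beta$ at which the $i$-th string is over the $j$-th string. $C(\beta)$ does not depend on the diagram. Free group and Magnus expansion. $F_m$ is the free group on $x_1,\dots,x_m$, $H=F_m^{\rm abel}$ its abelianization,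 $[x]\in H$ the class of $x\in F_m$, and $X_i=[x_i]$, so $H$ is free abelian with basis $X_1,\dots,X_m$. Let $\widehat T=\prod_{n\ge0}H^{\otimes n}$ be the completed tensor algebra. The standard Magnus expansion is the unique map $\theta:F_m\to\widehat T$ with $\theta(e)=1$, $\theta(xy)=\theta(x)\theta(y)$ and $\theta(x_i)=1+X_i$; $\theta_2(x)\in H^{\otimes 2}$ denotes the degree-two component of $\theta(x)$. Extended first Johnson homomorphism. For $\varphi\in\mathrm{Aut}(F_m)$ let $|\varphi|\in\mathrm{Aut}(H)$ be the induced automorphism. Then $\tau_1^\theta(\varphi)\in\mathrm{Hom}(H,H^{\otimes2})$ is the (well-defined) homomorphism \[ \tau_1^\theta(\varphi)([x])=\theta_2(x)-|\varphi|^{\otimes2}\big(\theta_2(\varphi^{-1}(x))\big),\qquad x\in F_m . \] The group $B_m$ is regarded as a subgroup of $\mathrm{Aut}(F_m)$ (products being compositions of functions) by the injective homomorphism given by $\sigma_i:\ x_i\mapsto x_{i+1},\ x_{i+1}\mapsto x_{i+1}^{-1}x_ix_{i+1},\ x_k\mapsto x_k$ ($k\ne i,i+1$). Regard $\wedge^2H\subset H^{\otimes2}$ via $X\wedge Y=X\otimes Y-Y\otimes X$; on $B_m$ the map $\tau_1^\theta$ takes values in $\mathrm{Hom}(H,\wedge^2H)$. The map $\delta$. For $M=(\alpha_{kl})\in\mathrm{Mat}_m^0$ put $f_i(M)=\sum_{k=1}^m\alpha_{ki}X_k\in H$, and for $\beta\in B_m$ put $f_i(\beta)=f_i(C(\beta))$.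 The map $\delta:\mathrm{Mat}_m^0\to\mathrm{Hom}(H,\wedge^2H)$ is given by $\delta(M)(X_i)=X_i\wedge f_i(M)$ for $1\le i\le m$. *)

theory Defs
  imports "HOL-Algebra.Algebra" "HOL-Library.Poly_Mapping"
begin

text \<open>The letter \<open>(g, True)\<close> stands for the generator \<open>g\<close>, the letter \<open>(g, False)\<close> for its inverse.\<close>

type_synonym 'g word = "('g \<times> bool) list"

definition words :: "'g set \<Rightarrow> 'g word set" where
  "words S = lists (S \<times> UNIV)"

inductive pres_eq :: "'g set \<Rightarrow> ('g word \<times> 'g word) set \<Rightarrow> 'g word \<Rightarrow> 'g word \<Rightarrow> bool"
  for S R where
  refl: "w \<in> words S \<Longrightarrow> pres_eq S R w w"
| sym: "pres_eq S R v w \<Longrightarrow> pres_eq S R w v"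
| trans: "pres_eq S R u v \<Longrightarrow> pres_eq S R v w \<Longrightarrow> pres_eq S R u w"
| cancel: "u \<in> words S \<Longrightarrow> v \<in> words S \<Longrightarrow> g \<in> S \<Longrightarrow>
    pres_eq S R (u @ [(g, e), (g, \<not> e)] @ v) (u @ v)"
| rel: "u \<in> words S \<Longrightarrow> v \<in> words S \<Longrightarrow> (l, r) \<in> R \<Longrightarrow> l \<in> words S \<Longrightarrow> r \<in> words S \<Longrightarrow>
    pres_eq S R (u @ l @ v) (u @ r @ v)"

definition pres_class :: "'g set \<Rightarrow> ('g word \<times> 'g word) set \<Rightarrow> 'g word \<Rightarrow> 'g word set" where
  "pres_class S R w = {v. pres_eq S R w v}"

definition presented_group :: "'g set \<Rightarrow> ('g word \<times> 'g word) set \<Rightarrow> 'g word set monoid" where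
  "presented_group S R =
     \<lparr>carrier = pres_class S R ` words S,
      monoid.mult = (\<lambda>A B. \<Union>a\<in>A. \<Union>b\<in>B. pres_class S R (a @ b)),
      one = pres_class S R []\<rparr>"

lemma words_append [simp]: "u @ v \<in> words S \<longleftrightarrow> u \<in> words S \<and> v \<in> words S"
  by (auto simp: words_def)

lemma words_Nil [simp]: "[] \<in> words S"
  by (auto simp: words_def)

lemma words_Cons [simp]: "x # v \<in> words S \<longleftrightarrow> fst x \<in> S \<and> v \<in> words S"
  by (cases x) (auto simp: words_def)

lemma pres_eq_words: "pres_eq S R v w \<Longrightarrow> v \<in> words S \<and> w \<in> words S"
  by (induction rule: pres_eq.induct) auto

lemma pres_eq_cong:
  assumes "pres_eq S R v w" "a \<in> words S" "b \<in> words S"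
  shows "pres_eq S R (a @ v @ b) (a @ w @ b)"
  using assms
proof (induction rule: pres_eq.induct)
  case (cancel u v g e)
  then show ?case using pres_eq.cancel[of "a @ u" S "v @ b" g R e] by simp
next
  case (rel u v l r)
  then show ?case using pres_eq.rel[of "a @ u" S "v @ b" l r R] by simp
next
  case (refl w)
  then show ?case by (intro pres_eq.refl) simp
next
  case (sym v w)
  show ?case by (rule pres_eq.sym[OF sym.IH[OF sym.prems]])
next
  case (trans u v w)
  show ?case by (rule pres_eq.trans[OF trans.IH(1)[OF trans.prems] trans.IH(2)[OF trans.prems]])
qed

lemma pres_eq_append:
  assumes "pres_eq S R u u'" "pres_eq S R v v'"
  shows "pres_eq S R (u @ v) (u' @ v')"
proof (rule pres_eq.trans)
  show "pres_eq S R (u @ v) (u' @ v)"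
    using pres_eq_cong[OF assms(1), of "[]" v] pres_eq_words[OF assms(2)] by simp
  show "pres_eq S R (u' @ v) (u' @ v')"
    using pres_eq_cong[OF assms(2), of u' "[]"] pres_eq_words[OF assms(1)] by simp
qed

lemma pres_class_eqI: "pres_eq S R v w \<Longrightarrow> pres_class S R v = pres_class S R w"
  unfolding pres_class_def
  by (intro Collect_cong iffI) (erule pres_eq.trans[OF pres_eq.sym] pres_eq.trans, assumption)+

lemma pres_class_mult:
  assumes "u \<in> words S" "v \<in> words S"
  shows "pres_class S R u \<otimes>\<^bsub>presented_group S R\<^esub> pres_class S R v = pres_class S R (u @ v)"
proof -
  have "pres_class S R (a @ b) = pres_class S R (u @ v)"
    if "a \<in> pres_class S R u" "b \<in> pres_class S R v" for a b
    using that unfolding pres_class_def mem_Collect_eq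
    by (intro pres_class_eqI[symmetric, unfolded pres_class_def] pres_eq_append)
  then have "(\<Union>a\<in>pres_class S R u. \<Union>b\<in>pres_class S R v. pres_class S R (a @ b)) =
      (\<Union>a\<in>pres_class S R u. \<Union>b\<in>pres_class S R v. pres_class S R (u @ v))"
    by simp
  moreover have "pres_class S R u \<noteq> {}" "pres_class S R v \<noteq> {}"
    using pres_eq.refl[OF assms(1), of R] pres_eq.refl[OF assms(2), of R]
    unfolding pres_class_def by blast+
  ultimately show ?thesis
    by (simp add: presented_group_def)
qed

lemma words_inverse: "w \<in> words S \<Longrightarrow> rev (map (\<lambda>(g, e). (g, \<not> e)) w) \<in> words S"
  by (induction w) auto

lemma pres_eq_inverse:
  "w \<in> words S \<Longrightarrow> pres_eq S R (rev (map (\<lambda>(g, e). (g, \<not> e)) w) @ w) []"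
proof (induction w)
  case Nil
  then show ?case by (simp add: pres_eq.refl)
next
  case (Cons x w)
  obtain g e where x: "x = (g, e)" by fastforce
  let ?i = "rev (map (\<lambda>(g, e). (g, \<not> e)) w)"
  have w: "w \<in> words S" "g \<in> S"
    using Cons.prems x by simp_all
  have "pres_eq S R (?i @ [(g, \<not> e), (g, \<not> \<not> e)] @ w) (?i @ w)"
    by (intro pres_eq.cancel words_inverse w)
  from pres_eq.trans[OF this Cons.IH[OF w(1)]] show ?case using x by simp
qed

lemma group_presented_group: "group (presented_group S R)"
proof (rule groupI)
  let ?G = "presented_group S R"
  have car: "carrier ?G = pres_class S R ` words S"
    and one: "\<one>\<^bsub>?G\<^esub> = pres_class S R []"
    by (auto simp: presented_group_def)
  show "\<one>\<^bsub>?G\<^esub> \<in> carrier ?G" by (auto simp: car one)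
  fix x assume "x \<in> carrier ?G"
  then obtain u where u: "u \<in> words S" "x = pres_class S R u" by (auto simp: car)
  show "\<one>\<^bsub>?G\<^esub> \<otimes>\<^bsub>?G\<^esub> x = x" using u by (simp add: one pres_class_mult)
  let ?u = "rev (map (\<lambda>(g, e). (g, \<not> e)) u)"
  have u': "?u \<in> words S" using u(1) by (rule words_inverse)
  have "pres_class S R ?u \<otimes>\<^bsub>?G\<^esub> x = \<one>\<^bsub>?G\<^esub>"
    unfolding u(2) one pres_class_mult[OF u' u(1)]
    by (intro pres_class_eqI pres_eq_inverse u(1))
  then show "\<exists>y\<in>carrier ?G. y \<otimes>\<^bsub>?G\<^esub> x = \<one>\<^bsub>?G\<^esub>"
    using u' unfolding car by blast
  fix y assume "y \<in> carrier ?G"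
  then obtain v where v: "v \<in> words S" "y = pres_class S R v" by (auto simp: car)
  show "x \<otimes>\<^bsub>?G\<^esub> y \<in> carrier ?G" using u v by (auto simp: car pres_class_mult)
  fix z assume "z \<in> carrier ?G"
  then obtain w where w: "w \<in> words S" "z = pres_class S R w" by (auto simp: car)
  show "x \<otimes>\<^bsub>?G\<^esub> y \<otimes>\<^bsub>?G\<^esub> z = x \<otimes>\<^bsub>?G\<^esub> (y \<otimes>\<^bsub>?G\<^esub> z)"
    using u v w by (simp add: pres_class_mult)
qed

definition braid_relations :: "nat \<Rightarrow> (nat word \<times> nat word) set" where
  "braid_relations m =
     {([(i, True), (j, True), (i, True)], [(j, True), (i, True), (j, True)]) | i j.
        i \<in> {1..<m} \<and> j \<in> {1..<m} \<and> (j = i + 1 \<or> i = j + 1)} \<union>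
     {([(i, True), (j, True)], [(j, True), (i, True)]) | i j.
        i \<in> {1..<m} \<and> j \<in> {1..<m} \<and> (i + 1 < j \<or> j + 1 < i)}"

definition braid_group :: "nat \<Rightarrow> nat word set monoid" where
  "braid_group m = presented_group {1..<m} (braid_relations m)"

definition sigma :: "nat \<Rightarrow> nat \<Rightarrow> nat word set" where
  "sigma m i = pres_class {1..<m} (braid_relations m) [(i, True)]"

text \<open>
  A word in the generators and their inverses, read from left to right, is a braid diagram read
  from top to bottom.  \<open>crossings s w\<close> lists the crossings of the diagram \<open>w\<close> as triples
  (over-string, under-string, sign), when \<open>s p\<close> is the name of the string entering the diagram at
  position \<open>p\<close> of the top.  In \<open>\<sigma>\<^sub>k\<close> the over-string is the one coming from position \<open>k + 1\<close>
  (positive crossing), in its inverse the one coming from position \<open>k\<close> (negative crossing).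
\<close>

fun crossings :: "(nat \<Rightarrow> nat) \<Rightarrow> nat word \<Rightarrow> (nat \<times> nat \<times> int) list" where
  "crossings s [] = []"
| "crossings s ((k, True) # w) =
     (s (k + 1), s k, 1) # crossings (s(k := s (k + 1), k + 1 := s k)) w"
| "crossings s ((k, False) # w) =
     (s k, s (k + 1), -1) # crossings (s(k := s (k + 1), k + 1 := s k)) w"

text \<open>An \<open>m \<times> m\<close> matrix is a function on index pairs, vanishing outside \<open>{1..m} \<times> {1..m}\<close>.\<close>

definition Mat0 :: "nat \<Rightarrow> (nat \<Rightarrow> nat \<Rightarrow> int) set" where
  "Mat0 m = {M. (\<forall>i j. M i j \<noteq> 0 \<longrightarrow> i \<in> {1..m} \<and> j \<in> {1..m}) \<and> (\<forall>i. M i i = 0)}"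

definition crossing_matrix_of_diagram :: "nat word \<Rightarrow> nat \<Rightarrow> nat \<Rightarrow> int" where
  "crossing_matrix_of_diagram w i j =
     (\<Sum>(a, b, e) \<leftarrow> crossings id w. if a = i \<and> b = j then e else 0)"

text \<open>A braid is a set of words, namely of all the diagrams representing it.\<close>

definition crossing_matrix :: "nat word set \<Rightarrow> nat \<Rightarrow> nat \<Rightarrow> int" where
  "crossing_matrix \<beta> = (THE M. \<forall>w\<in>\<beta>. M = crossing_matrix_of_diagram w)"

definition free_group :: "nat \<Rightarrow> nat word set monoid" where
  "free_group m = presented_group {1..m} {}"

definition x_gen :: "nat \<Rightarrow> nat \<Rightarrow> nat word set" where
  "x_gen m i = pres_class {1..m} {} [(i, True)]"

text \<open>The multiplication of \<^const>\<open>AutoGroup\<close> is composition of functions.\<close>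

definition artin_rep :: "nat \<Rightarrow> nat word set \<Rightarrow> nat word set \<Rightarrow> nat word set" where
  "artin_rep m = (THE \<rho>.
     \<rho> \<in> hom (braid_group m) (AutoGroup (free_group m)) \<and>
     \<rho> \<in> extensional (carrier (braid_group m)) \<and>
     (\<forall>i\<in>{1..<m}.
        \<rho> (sigma m i) (x_gen m i) = x_gen m (i + 1) \<and>
        \<rho> (sigma m i) (x_gen m (i + 1)) =
          inv\<^bsub>free_group m\<^esub> x_gen m (i + 1) \<otimes>\<^bsub>free_group m\<^esub> x_gen m i \<otimes>\<^bsub>free_group m\<^esub> x_gen m (i + 1) \<and>
        (\<forall>k\<in>{1..m} - {i, i + 1}. \<rho> (sigma m i) (x_gen m k) = x_gen m k)))"

text \<open>
  All abelian groups below are HOL-Algebra groups and hence written multiplicatively.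
  The elements of \<open>A\<^bsup>\<otimes>n\<^esup>\<close> are cosets of formal integral combinations of \<open>n\<close>-tuples of elements
  of \<open>A\<close>, modulo additivity in each entry.
\<close>

type_synonym 'a tensor = "('a list \<Rightarrow>\<^sub>0 int) set"

definition tuples :: "('a, 'b) monoid_scheme \<Rightarrow> nat \<Rightarrow> 'a list set" where
  "tuples A n = {xs. length xs = n \<and> set xs \<subseteq> carrier A}"

definition tensor_relators :: "('a, 'b) monoid_scheme \<Rightarrow> nat \<Rightarrow> ('a list \<Rightarrow>\<^sub>0 int) set" where
  "tensor_relators A n =
     {frag_of (us @ (a \<otimes>\<^bsub>A\<^esub> b) # vs) - frag_of (us @ a # vs) - frag_of (us @ b # vs) | us a b vs.
        us @ a # vs \<in> tuples A n \<and> us @ b # vs \<in> tuples A n}"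

definition tensor_kernel :: "('a, 'b) monoid_scheme \<Rightarrow> nat \<Rightarrow> ('a list \<Rightarrow>\<^sub>0 int) set" where
  "tensor_kernel A n = generate (free_Abelian_group (tuples A n)) (tensor_relators A n)"

definition tensor_power :: "('a, 'b) monoid_scheme \<Rightarrow> nat \<Rightarrow> 'a tensor monoid" where
  "tensor_power A n = free_Abelian_group (tuples A n) Mod tensor_kernel A n"

definition tensor_class :: "('a, 'b) monoid_scheme \<Rightarrow> nat \<Rightarrow> ('a list \<Rightarrow>\<^sub>0 int) \<Rightarrow> 'a tensor" where
  "tensor_class A n p = tensor_kernel A n #>\<^bsub>free_Abelian_group (tuples A n)\<^esub> p"

definition pure_tensor :: "('a, 'b) monoid_scheme \<Rightarrow> 'a list \<Rightarrow> 'a tensor" where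
  "pure_tensor A xs = tensor_class A (length xs) (frag_of xs)"

definition tensor_map ::
    "('a, 'b) monoid_scheme \<Rightarrow> ('a \<Rightarrow> 'a) \<Rightarrow> nat \<Rightarrow> 'a tensor \<Rightarrow> 'a tensor" where
  "tensor_map A f n P = (\<Union>p\<in>P. tensor_class A n (frag_extend (\<lambda>xs. frag_of (map f xs)) p))"

text \<open>The product \<open>A\<^bsup>\<otimes>k\<^esup> \<times> A\<^bsup>\<otimes>l\<^esup> \<rightarrow> A\<^bsup>\<otimes>(k+l)\<^esup>\<close> induced by concatenation of tuples.\<close>

definition tensor_mult ::
    "('a, 'b) monoid_scheme \<Rightarrow> nat \<Rightarrow> nat \<Rightarrow> 'a tensor \<Rightarrow> 'a tensor \<Rightarrow> 'a tensor" where
  "tensor_mult A k l P Q = (\<Union>p\<in>P. \<Union>q\<in>Q.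
     tensor_class A (k + l)
       (frag_extend (\<lambda>xs. frag_extend (\<lambda>ys. frag_of (xs @ ys)) q) p))"

definition completed_tensor_algebra :: "('a, 'b) monoid_scheme \<Rightarrow> (nat \<Rightarrow> 'a tensor) ring" where
  "completed_tensor_algebra A =
     \<lparr>carrier = {t. \<forall>n. t n \<in> carrier (tensor_power A n)},
      monoid.mult = (\<lambda>s t n. \<Otimes>\<^bsub>tensor_power A n\<^esub> k\<in>{..n}. tensor_mult A k (n - k) (s k) (t (n - k))),
      one = (\<lambda>n. if n = 0 then pure_tensor A [] else \<one>\<^bsub>tensor_power A n\<^esub>),
      ring.zero = (\<lambda>n. \<one>\<^bsub>tensor_power A n\<^esub>),
      add = (\<lambda>s t n. s n \<otimes>\<^bsub>tensor_power A n\<^esub> t n)\<rparr>"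

definition degree_one :: "('a, 'b) monoid_scheme \<Rightarrow> 'a \<Rightarrow> nat \<Rightarrow> 'a tensor" where
  "degree_one A a = (\<lambda>n. if n = 1 then pure_tensor A [a] else \<one>\<^bsub>tensor_power A n\<^esub>)"

definition wedge :: "('a, 'b) monoid_scheme \<Rightarrow> 'a \<Rightarrow> 'a \<Rightarrow> 'a tensor" where
  "wedge A a b =
     pure_tensor A [a, b] \<otimes>\<^bsub>tensor_power A 2\<^esub> inv\<^bsub>tensor_power A 2\<^esub> pure_tensor A [b, a]"

text \<open>The exterior square is regarded as a subgroup of \<open>A\<^bsup>\<otimes>2\<^esup>\<close> via \<open>a \<and> b = a \<otimes> b - b \<otimes> a\<close>.\<close>

definition ext_square :: "('a, 'b) monoid_scheme \<Rightarrow> 'a tensor monoid" where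
  "ext_square A = (tensor_power A 2)
     \<lparr>carrier := generate (tensor_power A 2) {wedge A a b | a b. a \<in> carrier A \<and> b \<in> carrier A}\<rparr>"

text \<open>Homomorphisms restricted to the carrier, so that equal homomorphisms are equal functions.\<close>

definition Hom :: "('a, 'b) monoid_scheme \<Rightarrow> ('c, 'd) monoid_scheme \<Rightarrow> ('a \<Rightarrow> 'c) set" where
  "Hom A B = hom A B \<inter> extensional (carrier A)"

text \<open>\<open>H_ab m\<close> is the abelianization of the free group; \<open>ab_class m x\<close> is \<open>[x]\<close>.\<close>

definition H_ab :: "nat \<Rightarrow> nat word set set monoid" where
  "H_ab m = free_group m Mod derived (free_group m) (carrier (free_group m))"

definition ab_class :: "nat \<Rightarrow> nat word set \<Rightarrow> nat word set set" where
  "ab_class m x = derived (free_group m) (carrier (free_group m)) #>\<^bsub>free_group m\<^esub> x"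

definition X_gen :: "nat \<Rightarrow> nat \<Rightarrow> nat word set set" where
  "X_gen m i = ab_class m (x_gen m i)"

definition magnus :: "nat \<Rightarrow> nat word set \<Rightarrow> nat \<Rightarrow> nat word set set tensor" where
  "magnus m = (let F = free_group m; T = completed_tensor_algebra (H_ab m) in
     THE \<theta>. \<theta> \<in> carrier F \<rightarrow>\<^sub>E carrier T \<and>
       \<theta> \<one>\<^bsub>F\<^esub> = \<one>\<^bsub>T\<^esub> \<and>
       (\<forall>x\<in>carrier F. \<forall>y\<in>carrier F. \<theta> (x \<otimes>\<^bsub>F\<^esub> y) = \<theta> x \<otimes>\<^bsub>T\<^esub> \<theta> y) \<and>
       (\<forall>i\<in>{1..m}. \<theta> (x_gen m i) = \<one>\<^bsub>T\<^esub> \<oplus>\<^bsub>T\<^esub> degree_one (H_ab m) (X_gen m i)))"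

text \<open>The map induced by an automorphism on the abelianization, \<open>[x] \<mapsto> [\<phi> x]\<close>.\<close>

definition ab_map :: "nat \<Rightarrow> (nat word set \<Rightarrow> nat word set) \<Rightarrow> nat word set set \<Rightarrow> nat word set set" where
  "ab_map m \<phi> = (\<lambda>h\<in>carrier (H_ab m). THE h'. \<forall>x\<in>h. h' = ab_class m (\<phi> x))"

definition johnson ::
    "nat \<Rightarrow> (nat word set \<Rightarrow> nat word set) \<Rightarrow> nat word set set \<Rightarrow> nat word set set tensor" where
  "johnson m \<phi> = (let F = free_group m; T2 = tensor_power (H_ab m) 2 in
     (\<lambda>h\<in>carrier (H_ab m). THE t. \<forall>x\<in>carrier F. ab_class m x = h \<longrightarrow>
       t = magnus m x 2 \<otimes>\<^bsub>T2\<^esub>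
           inv\<^bsub>T2\<^esub> tensor_map (H_ab m) (ab_map m \<phi>) 2 (magnus m ((inv\<^bsub>AutoGroup F\<^esub> \<phi>) x) 2)))"

definition f_vec :: "nat \<Rightarrow> nat \<Rightarrow> (nat \<Rightarrow> nat \<Rightarrow> int) \<Rightarrow> nat word set set" where
  "f_vec m i M = (\<Otimes>\<^bsub>H_ab m\<^esub> k\<in>{1..m}. X_gen m k [^]\<^bsub>H_ab m\<^esub> M k i)"

definition delta ::
    "nat \<Rightarrow> (nat \<Rightarrow> nat \<Rightarrow> int) \<Rightarrow> nat word set set \<Rightarrow> nat word set set tensor" where
  "delta m = (\<lambda>M\<in>Mat0 m. THE h. h \<in> Hom (H_ab m) (ext_square (H_ab m)) \<and>
     (\<forall>i\<in>{1..m}. h (X_gen m i) = wedge (H_ab m) (X_gen m i) (f_vec m i M)))"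

end

theory Submission
  imports Defs
begin

text \<open>
  Every map to be computed is determined by generators. In low degrees
  \<open>\<theta>\<^sub>0(x) = 1\<close> and \<open>\<theta>\<^sub>1(x) = [x]\<close>, so
  \<open>\<theta>\<^sub>2(xy) = \<theta>\<^sub>2(x) + [x] \<otimes> [y] + \<theta>\<^sub>2(y)\<close>; in the difference
  \<open>\<theta>\<^sub>2(x) - |\<phi>| \<theta>\<^sub>2(\<phi>\<inverse> x)\<close> the middle terms cancel, so that it is a homomorphism in \<open>x\<close>
  and descends to \<open>H\<close>. It satisfies the cocycle identity
  \<open>\<tau>(\<phi>\<psi>) = \<tau>(\<phi>) + |\<phi>| \<tau>(\<psi>) |\<phi>|\<inverse>\<close>. The crossing matrix obeys the matching rule when a letter
  is put in front of a braid word, because the letter \<open>\<sigma>\<^sub>k\<close> permutes both the strings and the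
  classes \<open>X\<^sub>i\<close> by the transposition of \<open>k\<close> and \<open>k + 1\<close>. Induction on the word therefore reduces
  the theorem to the letters \<open>\<sigma>\<^sub>k\<close> and their inverses.
\<close>

section \<open>Homomorphisms out of presented groups\<close>

text \<open>\<open>crossing_matrix\<close>, \<open>artin_rep\<close>, \<open>magnus\<close>,
  \<open>johnson\<close> and \<open>delta\<close> all rest on definite descriptions, and this shapes
  the proof: each must be shown to describe exactly one object. For maps out of the free group and
  the braid group this is von Dyck's theorem. The Magnus expansion does not take values in a given
  group, so the theorem is applied to the units of the completed tensor algebra, where 1 + X_i is
  inverted by its alternating geometric series. For \<open>delta\<close> the Johnson homomorphism of
  the braid itself is the object described.

  The under-string is the column index of the crossing matrix for the following reason. \<theta>_2
  vanishes on generators, and \<tau>(\<phi>)(X_p) sees only \<phi>\<inverse>(x_p). For a letter this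
  is again a generator unless p is the under-string of its one crossing; then it is a proper
  conjugate, and the class of the conjugating element, moved by |\<phi>|, is up to sign the class X
  of the over-string.\<close>

fun word_eval :: "('a, 'b) monoid_scheme \<Rightarrow> ('g \<Rightarrow> 'a) \<Rightarrow> 'g word \<Rightarrow> 'a" where
  "word_eval G f [] = \<one>\<^bsub>G\<^esub>"
| "word_eval G f ((g, e) # w) = (if e then f g else inv\<^bsub>G\<^esub> f g) \<otimes>\<^bsub>G\<^esub> word_eval G f w"

lemma carrier_presented_group: "carrier (presented_group S R) = pres_class S R ` words S"
  by (simp add: presented_group_def)

lemma one_presented_group: "\<one>\<^bsub>presented_group S R\<^esub> = pres_class S R []"
  by (simp add: presented_group_def)

lemma pres_class_closed [intro]: "w \<in> words S \<Longrightarrow> pres_class S R w \<in> carrier (presented_group S R)"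
  by (simp add: carrier_presented_group)

lemma pres_class_self: "w \<in> words S \<Longrightarrow> w \<in> pres_class S R w"
  by (simp add: pres_class_def pres_eq.refl)

lemma inv_pres_class_gen:
  assumes "g \<in> S"
  shows "inv\<^bsub>presented_group S R\<^esub> pres_class S R [(g, True)] = pres_class S R [(g, False)]"
proof -
  interpret group "presented_group S R" by (rule group_presented_group)
  have "pres_eq S R [(g, False), (g, True)] []"
    using pres_eq.cancel[of "[]" S "[]" g R False] assms by simp
  then have "pres_class S R [(g, False)] \<otimes>\<^bsub>presented_group S R\<^esub> pres_class S R [(g, True)] =
      \<one>\<^bsub>presented_group S R\<^esub>"
    using assms by (subst pres_class_mult) (simp_all add: one_presented_group pres_class_eqI)
  then show ?thesis using assms by (intro inv_equality pres_class_closed) simp_all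
qed

context group
begin

lemma word_eval_closed [simp]:
  "f \<in> S \<rightarrow> carrier G \<Longrightarrow> w \<in> words S \<Longrightarrow> word_eval G f w \<in> carrier G"
  by (induction w) (auto simp: Pi_iff)

lemma word_eval_append:
  assumes "f \<in> S \<rightarrow> carrier G" "u \<in> words S" "v \<in> words S"
  shows "word_eval G f (u @ v) = word_eval G f u \<otimes> word_eval G f v"
  using assms(2)
proof (induction u)
  case (Cons x u)
  then show ?case using assms by (cases x) (auto simp: m_assoc Pi_iff)
qed (use assms in simp)

text \<open>Each generating move of \<open>pres_eq\<close> preserves the value: a cancelling pair
  evaluates to \<open>f g\<close> and its inverse in one of the two orders, and a relation is
  applied between fixed outer words.\<close>

lemma word_eval_pres_eq:
  assumes "pres_eq S R v w" "f \<in> S \<rightarrow> carrier G"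
    and "\<And>l r. (l, r) \<in> R \<Longrightarrow> l \<in> words S \<Longrightarrow> r \<in> words S \<Longrightarrow> word_eval G f l = word_eval G f r"
  shows "word_eval G f v = word_eval G f w"
  using assms(1)
proof (induction rule: pres_eq.induct)
  case (cancel u v g e)
  then have "f g \<in> carrier G" using assms(2) by auto
  then have "word_eval G f [(g, e), (g, \<not> e)] = \<one>" by simp
  then show ?case using cancel assms(2)
    by (subst word_eval_append[of f S], simp, simp, simp, subst word_eval_append[of f S])
      (simp_all add: word_eval_append[of f S])
next
  case (rel u v l r)
  then show ?case using assms(2) assms(3)[of l r] by (simp add: word_eval_append[of f S])
qed auto

text \<open>Von Dyck's theorem. A representative of the class is chosen and evaluated, and
  \<open>word_eval_pres_eq\<close> makes the choice irrelevant. Extensionality is recorded because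
  \<open>artin_rep\<close> and \<open>magnus\<close> are described among extensional
  functions.\<close>

theorem presented_group_hom_exists:
  assumes "f \<in> S \<rightarrow> carrier G"
    and "\<And>l r. (l, r) \<in> R \<Longrightarrow> l \<in> words S \<Longrightarrow> r \<in> words S \<Longrightarrow> word_eval G f l = word_eval G f r"
  obtains h where "h \<in> hom (presented_group S R) G" "h \<in> extensional (carrier (presented_group S R))"
    "\<And>w. w \<in> words S \<Longrightarrow> h (pres_class S R w) = word_eval G f w"
proof
  let ?P = "presented_group S R"
  let ?h = "\<lambda>A\<in>carrier ?P. word_eval G f (SOME w. w \<in> A)"
  show h: "?h (pres_class S R w) = word_eval G f w" if "w \<in> words S" for w
  proof -
    have "(SOME v. v \<in> pres_class S R w) \<in> pres_class S R w"
      using pres_class_self[OF that] by (rule someI)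
    then have "word_eval G f (SOME v. v \<in> pres_class S R w) = word_eval G f w"
      using word_eval_pres_eq[of S R w _ f] assms by (simp add: pres_class_def)
    then show ?thesis using that by auto
  qed
  show "?h \<in> hom ?P G"
  proof (rule homI)
    fix A assume "A \<in> carrier ?P"
    then obtain u where u: "u \<in> words S" "A = pres_class S R u" by (auto simp: carrier_presented_group)
    show "?h A \<in> carrier G" unfolding u(2) h[OF u(1)] using assms u by simp
    fix B assume "B \<in> carrier ?P"
    then obtain v where v: "v \<in> words S" "B = pres_class S R v" by (auto simp: carrier_presented_group)
    have uv: "u @ v \<in> words S" using u v by simp
    show "?h (A \<otimes>\<^bsub>?P\<^esub> B) = ?h A \<otimes> ?h B"
      unfolding u(2) v(2) pres_class_mult[OF u(1) v(1)] h[OF uv] h[OF u(1)] h[OF v(1)]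
      using assms u v by (simp add: word_eval_append)
  qed
  show "?h \<in> extensional (carrier ?P)" by (rule restrict_extensional)
qed

lemma hom_pres_class:
  assumes "h \<in> hom (presented_group S R) G" "w \<in> words S"
  shows "h (pres_class S R w) = word_eval G (\<lambda>g. h (pres_class S R [(g, True)])) w"
  using assms(2)
proof (induction w)
  case Nil
  have "group_hom (presented_group S R) G h"
    using assms(1) by (simp add: group_hom_def group_hom_axioms_def group_presented_group)
  from group_hom.hom_one[OF this] show ?case by (simp add: one_presented_group)
next
  case (Cons x w)
  obtain g e where x: "x = (g, e)" by fastforce
  have gw: "g \<in> S" "w \<in> words S" using Cons.prems x by auto
  interpret h: group_hom "presented_group S R" G h
    using assms(1) by (simp add: group_hom_def group_hom_axioms_def group_presented_group)
  have "h (pres_class S R (x # w)) = h (pres_class S R [(g, e)]) \<otimes> h (pres_class S R w)"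
    using gw pres_class_mult[of "[(g, e)]" S w R]
    by (subst h.hom_mult[symmetric]) (auto simp: x)
  also have "h (pres_class S R [(g, e)]) = (if e then h (pres_class S R [(g, True)]) else
      inv h (pres_class S R [(g, True)]))"
    using gw h.hom_inv[of "pres_class S R [(g, True)]"] pres_class_closed[of "[(g, True)]" S R]
    by (cases e) (auto simp: inv_pres_class_gen)
  finally show ?case using Cons.IH[OF gw(2)] by (simp add: x)
qed

lemma word_eval_cong:
  "w \<in> words S \<Longrightarrow> (\<And>g. g \<in> S \<Longrightarrow> f g = f' g) \<Longrightarrow> word_eval G f w = word_eval G f' w"
  by (induction w) auto

theorem presented_group_hom_eq:
  assumes "h \<in> hom (presented_group S R) G" "h' \<in> hom (presented_group S R) G"
    and "\<And>g. g \<in> S \<Longrightarrow> h (pres_class S R [(g, True)]) = h' (pres_class S R [(g, True)])"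
    and "x \<in> carrier (presented_group S R)"
  shows "h x = h' x"
proof -
  obtain w where w: "w \<in> words S" "x = pres_class S R w"
    using assms(4) by (auto simp: carrier_presented_group)
  show ?thesis
    unfolding w(2) hom_pres_class[OF assms(1) w(1)] hom_pres_class[OF assms(2) w(1)]
    using w(1) assms(3) by (rule word_eval_cong)
qed

end

text \<open>Serves statements that are not equations between homomorphisms. A word is built by
  putting generators and their inverses in front one at a time, so \<open>P\<close> need not be
  closed under arbitrary products.\<close>

lemma presented_group_induct [consumes 1, case_names one gen inv]:
  assumes "x \<in> carrier (presented_group S R)"
    and "P \<one>\<^bsub>presented_group S R\<^esub>"
    and "\<And>g y. g \<in> S \<Longrightarrow> y \<in> carrier (presented_group S R) \<Longrightarrow> P y \<Longrightarrow>
      P (pres_class S R [(g, True)] \<otimes>\<^bsub>presented_group S R\<^esub> y)"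
    and "\<And>g y. g \<in> S \<Longrightarrow> y \<in> carrier (presented_group S R) \<Longrightarrow> P y \<Longrightarrow>
      P (inv\<^bsub>presented_group S R\<^esub> pres_class S R [(g, True)] \<otimes>\<^bsub>presented_group S R\<^esub> y)"
  shows "P x"
proof -
  have "w \<in> words S \<Longrightarrow> P (pres_class S R w)" for w
  proof (induction w)
    case (Cons x w)
    obtain g e where x: "x = (g, e)" by fastforce
    have gw: "g \<in> S" "w \<in> words S" "P (pres_class S R w)" using Cons x by auto
    show ?case
      using assms(3)[OF gw(1) pres_class_closed[OF gw(2)] gw(3)]
        assms(4)[OF gw(1) pres_class_closed[OF gw(2)] gw(3)] gw
      by (cases e) (simp_all add: x inv_pres_class_gen pres_class_mult)
  qed (use assms(2) in \<open>simp add: one_presented_group\<close>)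
  then show ?thesis using assms(1) by (auto simp: carrier_presented_group)
qed

section \<open>Tensor powers and the completed tensor algebra\<close>

lemma tuples_append [simp]: "xs \<in> tuples A k \<Longrightarrow> ys \<in> tuples A l \<Longrightarrow> xs @ ys \<in> tuples A (k + l)"
  by (auto simp: tuples_def)

text \<open>Concatenation extended bilinearly, on representatives instead of cosets. All lengths
  share one type, so associativity and the unit laws hold as plain equations without any bookkeeping
  of degrees.\<close>

definition chain_mult :: "('a list \<Rightarrow>\<^sub>0 int) \<Rightarrow> ('a list \<Rightarrow>\<^sub>0 int) \<Rightarrow> ('a list \<Rightarrow>\<^sub>0 int)" where
  "chain_mult p q = frag_extend (\<lambda>xs. frag_extend (\<lambda>ys. frag_of (xs @ ys)) q) p"

lemmas frag_induct = frag_induction[OF subset_UNIV, case_names zero one diff]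

text \<open>The second factor of \<open>chain_mult\<close> sits inside the function being extended,
  so linearity in that factor comes from linearity in the function.\<close>

lemma frag_extend_fun_diff:
  "frag_extend (\<lambda>x. f x - g x) p = frag_extend f p - frag_extend g p"
  by (induction p rule: frag_induct) (simp_all add: frag_extend_diff)

lemma chain_mult_of [simp]: "chain_mult (frag_of xs) (frag_of ys) = frag_of (xs @ ys)"
  by (simp add: chain_mult_def)

lemma chain_mult_zero [simp]: "chain_mult 0 q = 0" "chain_mult p 0 = 0"
  by (simp_all add: chain_mult_def frag_extend_eq_0)

lemma chain_mult_diff:
  "chain_mult (p - p') q = chain_mult p q - chain_mult p' q"
  "chain_mult p (q - q') = chain_mult p q - chain_mult p q'"
  by (simp_all add: chain_mult_def frag_extend_diff frag_extend_fun_diff)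

lemma chain_mult_add:
  "chain_mult (p + p') q = chain_mult p q + chain_mult p' q"
  "chain_mult p (q + q') = chain_mult p q + chain_mult p q'"
proof -
  \<comment> \<open>The sum is read as f - (0 - g), so that the rule for differences applies
    twice.\<close>
  have "frag_extend (\<lambda>x. f x + g x) p = frag_extend f p + frag_extend g p"
    for f g :: "'a list \<Rightarrow> 'a list \<Rightarrow>\<^sub>0 int" and p
    using frag_extend_fun_diff[of f "\<lambda>x. - g x" p] frag_extend_fun_diff[of "\<lambda>x. 0" g p]
    by (simp add: frag_extend_eq_0)
  then show "chain_mult (p + p') q = chain_mult p q + chain_mult p' q"
    "chain_mult p (q + q') = chain_mult p q + chain_mult p q'"
    by (simp_all add: chain_mult_def frag_extend_add)
qed

lemma chain_mult_sum:
  "chain_mult (\<Sum>i\<in>I. f i) q = (\<Sum>i\<in>I. chain_mult (f i) q)"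
  "chain_mult q (\<Sum>i\<in>I. f i) = (\<Sum>i\<in>I. chain_mult q (f i))"
  by (induction I rule: infinite_finite_induct) (simp_all add: chain_mult_add)

lemma chain_mult_assoc: "chain_mult (chain_mult p q) r = chain_mult p (chain_mult q r)"
proof (induction p rule: frag_induct)
  case (one xs)
  show ?case
  proof (induction q rule: frag_induct)
    case (one ys)
    show ?case by (induction r rule: frag_induct) (simp_all add: chain_mult_diff)
  qed (simp_all add: chain_mult_diff)
qed (simp_all add: chain_mult_diff)

lemma chain_mult_Nil [simp]: "chain_mult (frag_of []) p = p" "chain_mult p (frag_of []) = p"
  by (induction p rule: frag_induct; simp add: chain_mult_diff)+

lemma chain_mult_closed:
  assumes "Poly_Mapping.keys p \<subseteq> tuples A k" "Poly_Mapping.keys q \<subseteq> tuples A l"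
  shows "Poly_Mapping.keys (chain_mult p q) \<subseteq> tuples A (k + l)"
proof -
  have "Poly_Mapping.keys (frag_extend (\<lambda>ys. frag_of (xs @ ys)) q) \<subseteq> tuples A (k + l)"
    if "xs \<in> tuples A k" for xs
    using keys_frag_extend[of "\<lambda>ys. frag_of (xs @ ys)" q] assms(2) that by fastforce
  then show ?thesis
    using keys_frag_extend[of "\<lambda>xs. frag_extend (\<lambda>ys. frag_of (xs @ ys)) q" p] assms(1)
    unfolding chain_mult_def by blast
qed

section \<open>Tensor powers of a commutative group as quotients of chains\<close>

context comm_group
begin

lemma tuples_Nil [simp]: "[] \<in> tuples G n \<longleftrightarrow> n = 0"
  by (auto simp: tuples_def)

lemma tuples_Cons [simp]: "x # xs \<in> tuples G n \<longleftrightarrow> x \<in> carrier G \<and> (\<exists>k. n = Suc k \<and> xs \<in> tuples G k)"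
  by (auto simp: tuples_def)

lemma tensor_relatorsI:
  "us @ a # vs \<in> tuples G n \<Longrightarrow> us @ b # vs \<in> tuples G n \<Longrightarrow>
    frag_of (us @ (a \<otimes> b) # vs) - frag_of (us @ a # vs) - frag_of (us @ b # vs) \<in> tensor_relators G n"
  unfolding tensor_relators_def by blast

lemma tensor_relators_closed: "r \<in> tensor_relators G n \<Longrightarrow> Poly_Mapping.keys r \<subseteq> tuples G n"
proof -
  assume "r \<in> tensor_relators G n"
  then obtain us a b vs where r: "us @ a # vs \<in> tuples G n" "us @ b # vs \<in> tuples G n"
    "r = frag_of (us @ (a \<otimes> b) # vs) - frag_of (us @ a # vs) - frag_of (us @ b # vs)"
    unfolding tensor_relators_def by blast
  have "us @ (a \<otimes> b) # vs \<in> tuples G n" using r by (auto simp: tuples_def)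
  then have "r \<in> carrier (free_Abelian_group (tuples G n))"
    unfolding r(3) carrier_free_Abelian_group_iff using r(1,2)
    by (intro order.trans[OF keys_diff] Un_least) auto
  then show ?thesis by simp
qed

lemma subgroup_tensor_kernel: "subgroup (tensor_kernel G n) (free_Abelian_group (tuples G n))"
  unfolding tensor_kernel_def
  by (rule group.generate_is_subgroup) (auto dest: subsetD[OF tensor_relators_closed])

lemma normal_tensor_kernel: "tensor_kernel G n \<lhd> free_Abelian_group (tuples G n)"
  by (rule comm_group.subgroup_imp_normal[OF abelian_free_Abelian_group subgroup_tensor_kernel])

lemma tensor_kernel_closed: "p \<in> tensor_kernel G n \<Longrightarrow> Poly_Mapping.keys p \<subseteq> tuples G n"
  by (drule subgroup.mem_carrier[OF subgroup_tensor_kernel]) simp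

text \<open>In \<open>generate\<close> only relators are inverted; that inverse is negation because
  the support of a relator consists of tuples.\<close>

lemma tensor_kernel_induct [consumes 1, case_names zero rel uminus add]:
  assumes "p \<in> tensor_kernel G n" "P 0" "\<And>r. r \<in> tensor_relators G n \<Longrightarrow> P r"
    "\<And>p. P p \<Longrightarrow> P (- p)" "\<And>p q. P p \<Longrightarrow> P q \<Longrightarrow> P (p + q)"
  shows "P p"
  using assms(1) unfolding tensor_kernel_def
proof (induction rule: generate.induct)
  case (inv h)
  then show ?case using assms(3,4) tensor_relators_closed by simp
qed (use assms in auto)

lemma tensor_kernel_zero: "0 \<in> tensor_kernel G n"
  using subgroup.one_closed[OF subgroup_tensor_kernel] by simp

lemma tensor_kernel_add:
  "p \<in> tensor_kernel G n \<Longrightarrow> q \<in> tensor_kernel G n \<Longrightarrow> p + q \<in> tensor_kernel G n"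
  using subgroup.m_closed[OF subgroup_tensor_kernel] by simp

lemma tensor_kernel_uminus: "p \<in> tensor_kernel G n \<Longrightarrow> - p \<in> tensor_kernel G n"
  using subgroup.m_inv_closed[OF subgroup_tensor_kernel, of p n] tensor_kernel_closed
  by simp

lemma tensor_kernel_diff:
  "p \<in> tensor_kernel G n \<Longrightarrow> q \<in> tensor_kernel G n \<Longrightarrow> p - q \<in> tensor_kernel G n"
  using tensor_kernel_add[OF _ tensor_kernel_uminus, of p n q] by simp

lemma tensor_kernel_rel: "r \<in> tensor_relators G n \<Longrightarrow> r \<in> tensor_kernel G n"
  unfolding tensor_kernel_def by (rule generate.incl)

lemma comm_group_tensor_power: "comm_group (tensor_power G n)"
  unfolding tensor_power_def
  by (rule comm_group.abelian_FactGroup[OF abelian_free_Abelian_group subgroup_tensor_kernel])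

lemma carrier_tensor_power:
  "carrier (tensor_power G n) = tensor_class G n ` {p. Poly_Mapping.keys p \<subseteq> tuples G n}"
  unfolding tensor_power_def carrier_FactGroup tensor_class_def[abs_def] by (auto simp: free_Abelian_group_def)

lemma tensor_class_hom:
  "tensor_class G n \<in> hom (free_Abelian_group (tuples G n)) (tensor_power G n)"
  using normal.r_coset_hom_Mod[OF normal_tensor_kernel, of n]
  unfolding tensor_class_def[abs_def] tensor_power_def .

lemma tensor_class_closed [simp]:
  "Poly_Mapping.keys p \<subseteq> tuples G n \<Longrightarrow> tensor_class G n p \<in> carrier (tensor_power G n)"
  by (simp add: carrier_tensor_power)

lemma tensor_class_add:
  assumes "Poly_Mapping.keys p \<subseteq> tuples G n" "Poly_Mapping.keys q \<subseteq> tuples G n"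
  shows "tensor_class G n (p + q) = tensor_class G n p \<otimes>\<^bsub>tensor_power G n\<^esub> tensor_class G n q"
  using hom_mult[OF tensor_class_hom, of p n q] assms by simp

lemma group_hom_tensor_class:
  "group_hom (free_Abelian_group (tuples G n)) (tensor_power G n) (tensor_class G n)"
  using comm_group_tensor_power[of n] tensor_class_hom
  by (simp add: group_hom_def group_hom_axioms_def comm_group_def)

lemma tensor_class_zero: "tensor_class G n 0 = \<one>\<^bsub>tensor_power G n\<^esub>"
  using group_hom.hom_one[OF group_hom_tensor_class] by simp

lemma tensor_class_mem_iff:
  assumes "Poly_Mapping.keys p \<subseteq> tuples G n"
  shows "q \<in> tensor_class G n p \<longleftrightarrow> Poly_Mapping.keys q \<subseteq> tuples G n \<and> q - p \<in> tensor_kernel G n"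
proof
  assume "q \<in> tensor_class G n p"
  then obtain h where h: "h \<in> tensor_kernel G n" "q = h + p"
    unfolding tensor_class_def r_coset_def by auto
  then show "Poly_Mapping.keys q \<subseteq> tuples G n \<and> q - p \<in> tensor_kernel G n"
    using subsetD[OF keys_add, of _ h p] tensor_kernel_closed[OF h(1)] assms by auto
next
  assume "Poly_Mapping.keys q \<subseteq> tuples G n \<and> q - p \<in> tensor_kernel G n"
  then show "q \<in> tensor_class G n p"
    unfolding tensor_class_def r_coset_def by (auto intro!: bexI[of _ "q - p"])
qed

lemma tensor_class_eqI:
  assumes "Poly_Mapping.keys p \<subseteq> tuples G n" "Poly_Mapping.keys q \<subseteq> tuples G n"
    "p - q \<in> tensor_kernel G n"
  shows "tensor_class G n p = tensor_class G n q"
proof -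
  have "p \<in> tensor_class G n q" using assms by (simp add: tensor_class_mem_iff)
  then show ?thesis
    using group.repr_independence[OF group_free_Abelian_group _ _ subgroup_tensor_kernel, of p n q] assms(2)
    unfolding tensor_class_def by simp
qed

text \<open>\<open>tensor_map\<close> and \<open>tensor_mult\<close> are unions over all
  representatives of a coset. If the summand is constant on the coset, the union collapses to its
  value at any chosen representative.\<close>

lemma tensor_class_UN:
  assumes "Poly_Mapping.keys p \<subseteq> tuples G n"
    and "\<And>q. Poly_Mapping.keys q \<subseteq> tuples G n \<Longrightarrow> q - p \<in> tensor_kernel G n \<Longrightarrow> f q = f p"
  shows "(\<Union>q\<in>tensor_class G n p. f q) = f p"
proof -
  have "p \<in> tensor_class G n p" using assms(1) by (simp add: tensor_class_mem_iff tensor_kernel_zero)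
  moreover have "f q = f p" if "q \<in> tensor_class G n p" for q
    using that assms by (simp add: tensor_class_mem_iff)
  ultimately show ?thesis by blast
qed

lemma tensor_class_finprod:
  assumes "\<And>i. i \<in> I \<Longrightarrow> Poly_Mapping.keys (f i) \<subseteq> tuples G n" "finite I"
  shows "(\<Otimes>\<^bsub>tensor_power G n\<^esub>i\<in>I. tensor_class G n (f i)) = tensor_class G n (\<Sum>i\<in>I. f i)"
  using assms(2,1)
proof (induction I rule: finite_induct)
  case empty
  interpret T: comm_group "tensor_power G n" by (rule comm_group_tensor_power)
  show ?case by (simp add: tensor_class_zero)
next
  case (insert i I)
  interpret T: comm_group "tensor_power G n" by (rule comm_group_tensor_power)
  have "Poly_Mapping.keys (\<Sum>i\<in>I. f i) \<subseteq> tuples G n"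
    using sum_closed_free_Abelian_group[of I f "tuples G n"] insert.prems by simp
  then show ?case using insert by (simp add: tensor_class_add Pi_iff)
qed

text \<open>With \<open>chain_mult_kernel_right\<close> this says that the kernels form a two-sided
  ideal. Appending a tuple to a relator merely lengthens its tail \<open>vs\<close> and gives a
  relator again; additivity in both factors does the rest.\<close>

lemma chain_mult_kernel_left:
  assumes "p \<in> tensor_kernel G k" "Poly_Mapping.keys q \<subseteq> tuples G l"
  shows "chain_mult p q \<in> tensor_kernel G (k + l)"
  using assms(2)
proof (induction q rule: frag_induction)
  case (one ys)
  show ?case using assms(1)
  proof (induction rule: tensor_kernel_induct)
    case (rel r)
    then obtain us a b vs where r: "us @ a # vs \<in> tuples G k" "us @ b # vs \<in> tuples G k"
      "r = frag_of (us @ (a \<otimes> b) # vs) - frag_of (us @ a # vs) - frag_of (us @ b # vs)"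
      unfolding tensor_relators_def by blast
    have "chain_mult r (frag_of ys) \<in> tensor_relators G (k + l)"
      using tuples_append[OF r(1) one] tuples_append[OF r(2) one] tensor_relatorsI[of us a "vs @ ys" "k + l" b]
      by (simp add: r(3) chain_mult_diff)
    then show ?case by (rule tensor_kernel_rel)
  next
    case (uminus p)
    then show ?case using tensor_kernel_uminus[OF uminus] chain_mult_diff(1)[of 0 p] by simp
  qed (simp_all add: tensor_kernel_zero tensor_kernel_add chain_mult_add)
qed (simp_all add: tensor_kernel_zero tensor_kernel_diff chain_mult_diff)

lemma chain_mult_kernel_right:
  assumes "q \<in> tensor_kernel G l" "Poly_Mapping.keys p \<subseteq> tuples G k"
  shows "chain_mult p q \<in> tensor_kernel G (k + l)"
  using assms(2)
proof (induction p rule: frag_induction)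
  case (one xs)
  show ?case using assms(1)
  proof (induction rule: tensor_kernel_induct)
    case (rel r)
    then obtain us a b vs where r: "us @ a # vs \<in> tuples G l" "us @ b # vs \<in> tuples G l"
      "r = frag_of (us @ (a \<otimes> b) # vs) - frag_of (us @ a # vs) - frag_of (us @ b # vs)"
      unfolding tensor_relators_def by blast
    have "chain_mult (frag_of xs) r \<in> tensor_relators G (k + l)"
      using tuples_append[OF one r(1)] tuples_append[OF one r(2)] tensor_relatorsI[of "xs @ us" a vs "k + l" b]
      by (simp add: r(3) chain_mult_diff)
    then show ?case by (rule tensor_kernel_rel)
  next
    case (uminus p)
    then show ?case using tensor_kernel_uminus[OF uminus] chain_mult_diff(2)[of _ 0 p] by simp
  qed (simp_all add: tensor_kernel_zero tensor_kernel_add chain_mult_add)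
qed (simp_all add: tensor_kernel_zero tensor_kernel_diff chain_mult_diff)

lemma tensor_mult_class:
  assumes p: "Poly_Mapping.keys p \<subseteq> tuples G k" and q: "Poly_Mapping.keys q \<subseteq> tuples G l"
  shows "tensor_mult G k l (tensor_class G k p) (tensor_class G l q) =
    tensor_class G (k + l) (chain_mult p q)"
proof -
  have eq: "tensor_class G (k + l) (chain_mult p' q') = tensor_class G (k + l) (chain_mult p q)"
    if p': "Poly_Mapping.keys p' \<subseteq> tuples G k" "p' - p \<in> tensor_kernel G k"
      and q': "Poly_Mapping.keys q' \<subseteq> tuples G l" "q' - q \<in> tensor_kernel G l" for p' q'
  proof (rule tensor_class_eqI)
    \<comment> \<open>Changing one factor at a time puts each difference into the ideal.\<close>
    have "chain_mult p' q' - chain_mult p q = chain_mult (p' - p) q' + chain_mult p (q' - q)"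
      by (simp add: chain_mult_diff)
    also have "\<dots> \<in> tensor_kernel G (k + l)"
      using p' q' p by (intro tensor_kernel_add chain_mult_kernel_left chain_mult_kernel_right)
    finally show "chain_mult p' q' - chain_mult p q \<in> tensor_kernel G (k + l)" .
  qed (use p' q' p q in \<open>simp_all add: chain_mult_closed\<close>)
  have "(\<Union>q'\<in>tensor_class G l q. tensor_class G (k + l) (chain_mult p' q')) =
      tensor_class G (k + l) (chain_mult p q)"
    if p': "Poly_Mapping.keys p' \<subseteq> tuples G k" "p' - p \<in> tensor_kernel G k" for p'
    using eq[OF p' q] eq[OF p'] by (subst tensor_class_UN[OF q]) (simp_all add: tensor_kernel_zero)
  then show ?thesis
    unfolding tensor_mult_def chain_mult_def[symmetric]
    by (subst tensor_class_UN[OF p]) (simp_all add: p tensor_kernel_zero)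
qed

lemma pure_tensor_closed [simp]:
  "set xs \<subseteq> carrier G \<Longrightarrow> n = length xs \<Longrightarrow> pure_tensor G xs \<in> carrier (tensor_power G n)"
  by (simp add: pure_tensor_def tuples_def)

lemma pure_tensor_mult:
  assumes "set us \<subseteq> carrier G" "set vs \<subseteq> carrier G" "a \<in> carrier G" "b \<in> carrier G"
    "n = Suc (length us + length vs)"
  shows "pure_tensor G (us @ (a \<otimes> b) # vs) =
    pure_tensor G (us @ a # vs) \<otimes>\<^bsub>tensor_power G n\<^esub> pure_tensor G (us @ b # vs)"
proof -
  have t: "us @ c # vs \<in> tuples G n" if "c \<in> carrier G" for c
    using that assms by (auto simp: tuples_def)
  have k: "Poly_Mapping.keys (frag_of (us @ a # vs) + frag_of (us @ b # vs)) \<subseteq> tuples G n"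
    using subsetD[OF keys_add, of _ "frag_of (us @ a # vs)" "frag_of (us @ b # vs)"] t assms by auto
  have "tensor_class G n (frag_of (us @ (a \<otimes> b) # vs)) =
      tensor_class G n (frag_of (us @ a # vs) + frag_of (us @ b # vs))"
    using t[of "a \<otimes> b"] assms(3,4) k tensor_kernel_rel[OF tensor_relatorsI[OF t t], of a b]
    by (intro tensor_class_eqI) (simp_all add: diff_diff_eq)
  then show ?thesis using t assms by (simp add: pure_tensor_def tensor_class_add)
qed

lemma pure_tensor2_mult:
  assumes "a \<in> carrier G" "b \<in> carrier G" "c \<in> carrier G"
  shows "pure_tensor G [a \<otimes> b, c] = pure_tensor G [a, c] \<otimes>\<^bsub>tensor_power G 2\<^esub> pure_tensor G [b, c]"
    and "pure_tensor G [c, a \<otimes> b] = pure_tensor G [c, a] \<otimes>\<^bsub>tensor_power G 2\<^esub> pure_tensor G [c, b]"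
  using pure_tensor_mult[of "[]" "[c]" a b 2] pure_tensor_mult[of "[c]" "[]" a b 2] assms by simp_all

text \<open>Applying a homomorphism entrywise sends relators to relators, hence the kernel to
  itself, so the induced map may be computed on any representative.\<close>

lemma tensor_map_class:
  assumes f: "f \<in> hom G G" and p: "Poly_Mapping.keys p \<subseteq> tuples G n"
  shows "tensor_map G f n (tensor_class G n p) =
    tensor_class G n (frag_extend (\<lambda>xs. frag_of (map f xs)) p)"
  unfolding tensor_map_def
proof (rule tensor_class_UN[OF p])
  let ?F = "frag_extend (\<lambda>xs. frag_of (map f xs))"
  have clo: "map f xs \<in> tuples G n" if "xs \<in> tuples G n" for xs
    using that f by (auto simp: tuples_def hom_def)
  then have F: "Poly_Mapping.keys (?F q) \<subseteq> tuples G n" if "Poly_Mapping.keys q \<subseteq> tuples G n" for q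
    using that keys_frag_extend[of "\<lambda>xs. frag_of (map f xs)" q] by fastforce
  have ker: "?F r \<in> tensor_kernel G n" if "r \<in> tensor_kernel G n" for r
    using that
  proof (induction rule: tensor_kernel_induct)
    case (rel r)
    then obtain us a b vs where r: "us @ a # vs \<in> tuples G n" "us @ b # vs \<in> tuples G n"
      "r = frag_of (us @ (a \<otimes> b) # vs) - frag_of (us @ a # vs) - frag_of (us @ b # vs)"
      unfolding tensor_relators_def by blast
    have "f (a \<otimes> b) = f a \<otimes> f b"
      using r f by (auto simp: tuples_def hom_def)
    then have "?F r \<in> tensor_relators G n"
      using clo[OF r(1)] clo[OF r(2)] tensor_relatorsI[of "map f us" "f a" "map f vs" n "f b"]
      by (simp add: r(3) frag_extend_diff)
    then show ?case by (rule tensor_kernel_rel)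
  qed (simp_all add: tensor_kernel_zero tensor_kernel_add tensor_kernel_uminus frag_extend_add
      frag_extend_minus)
  fix q assume "Poly_Mapping.keys q \<subseteq> tuples G n" "q - p \<in> tensor_kernel G n"
  then show "tensor_class G n (?F q) = tensor_class G n (?F p)"
    using F p ker[of "q - p"] by (intro tensor_class_eqI) (simp_all add: frag_extend_diff)
qed

lemma frag_map_closed:
  assumes "f \<in> hom G G" "Poly_Mapping.keys p \<subseteq> tuples G n"
  shows "Poly_Mapping.keys (frag_extend (\<lambda>xs. frag_of (map f xs)) p) \<subseteq> tuples G n"
proof -
  have "map f xs \<in> tuples G n" if "xs \<in> tuples G n" for xs
    using that assms by (auto simp: tuples_def hom_def)
  then show ?thesis
    using assms keys_frag_extend[of "\<lambda>xs. frag_of (map f xs)" p] by fastforce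
qed

lemma tensor_map_hom:
  assumes f: "f \<in> hom G G"
  shows "tensor_map G f n \<in> hom (tensor_power G n) (tensor_power G n)"
proof (rule homI)
  fix P assume "P \<in> carrier (tensor_power G n)"
  then obtain p where p: "Poly_Mapping.keys p \<subseteq> tuples G n" "P = tensor_class G n p"
    by (auto simp: carrier_tensor_power)
  show "tensor_map G f n P \<in> carrier (tensor_power G n)"
    using p f by (simp add: tensor_map_class frag_map_closed)
  fix Q assume "Q \<in> carrier (tensor_power G n)"
  then obtain q where q: "Poly_Mapping.keys q \<subseteq> tuples G n" "Q = tensor_class G n q"
    by (auto simp: carrier_tensor_power)
  have "Poly_Mapping.keys (p + q) \<subseteq> tuples G n"
    using subsetD[OF keys_add, of _ p q] p q by auto
  then show "tensor_map G f n (P \<otimes>\<^bsub>tensor_power G n\<^esub> Q) =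
      tensor_map G f n P \<otimes>\<^bsub>tensor_power G n\<^esub> tensor_map G f n Q"
    using p q f
    by (simp add: tensor_map_class frag_map_closed frag_extend_add flip: tensor_class_add)
qed

lemma tensor_map_pure:
  "f \<in> hom G G \<Longrightarrow> set xs \<subseteq> carrier G \<Longrightarrow> n = length xs \<Longrightarrow>
    tensor_map G f n (pure_tensor G xs) = pure_tensor G (map f xs)"
  by (simp add: pure_tensor_def tensor_map_class tuples_def)

text \<open>Agreement on the carrier is the right hypothesis here: \<open>ab_map\<close> of a
  composite and the composite of the two \<open>ab_map\<close>s are compared only there.\<close>

lemma tensor_map_cong:
  assumes "f \<in> hom G G" "g \<in> hom G G" "\<And>x. x \<in> carrier G \<Longrightarrow> f x = g x"
    "P \<in> carrier (tensor_power G n)"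
  shows "tensor_map G f n P = tensor_map G g n P"
proof -
  obtain p where p: "Poly_Mapping.keys p \<subseteq> tuples G n" "P = tensor_class G n p"
    using assms(4) by (auto simp: carrier_tensor_power)
  have "map f xs = map g xs" if "xs \<in> Poly_Mapping.keys p" for xs
    using that subsetD[OF p(1) that] assms(3) by (auto simp: tuples_def)
  then have "frag_extend (\<lambda>xs. frag_of (map f xs)) p = frag_extend (\<lambda>xs. frag_of (map g xs)) p"
    by (intro frag_extend_eq) (simp only:)
  then show ?thesis using p by (simp add: tensor_map_class assms(1,2))
qed

lemma tensor_map_compose:
  assumes "f \<in> hom G G" "g \<in> hom G G" "P \<in> carrier (tensor_power G n)"
  shows "tensor_map G f n (tensor_map G g n P) = tensor_map G (f \<circ> g) n P"
proof -
  obtain p where p: "Poly_Mapping.keys p \<subseteq> tuples G n" "P = tensor_class G n p"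
    using assms(3) by (auto simp: carrier_tensor_power)
  have fg: "f \<circ> g \<in> hom G G" using Group.hom_compose[OF assms(2,1)] .
  have "frag_extend (\<lambda>xs. frag_of (map f xs)) (frag_extend (\<lambda>xs. frag_of (map g xs)) p) =
      frag_extend (\<lambda>xs. frag_of (map (f \<circ> g) xs)) p"
    using frag_extend_compose[of "\<lambda>xs. frag_of (map f xs)" "map g" p] by (simp add: o_def)
  then show ?thesis using assms p fg by (simp add: tensor_map_class frag_map_closed)
qed

end

section \<open>Formal series of chains and the inverse of 1 + a\<close>

definition series_class :: "('a, 'b) monoid_scheme \<Rightarrow> (nat \<Rightarrow> 'a list \<Rightarrow>\<^sub>0 int) \<Rightarrow> nat \<Rightarrow> 'a tensor" where
  "series_class A s = (\<lambda>n. tensor_class A n (s n))"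

definition series :: "('a, 'b) monoid_scheme \<Rightarrow> (nat \<Rightarrow> 'a list \<Rightarrow>\<^sub>0 int) set" where
  "series A = {s. \<forall>n. Poly_Mapping.keys (s n) \<subseteq> tuples A n}"

definition series_mult ::
    "(nat \<Rightarrow> 'a list \<Rightarrow>\<^sub>0 int) \<Rightarrow> (nat \<Rightarrow> 'a list \<Rightarrow>\<^sub>0 int) \<Rightarrow> nat \<Rightarrow> 'a list \<Rightarrow>\<^sub>0 int" where
  "series_mult s t = (\<lambda>n. \<Sum>k\<le>n. chain_mult (s k) (t (n - k)))"

definition series_one :: "nat \<Rightarrow> 'a list \<Rightarrow>\<^sub>0 int" where
  "series_one = (\<lambda>n. if n = 0 then frag_of [] else 0)"

definition one_plus :: "'a \<Rightarrow> nat \<Rightarrow> 'a list \<Rightarrow>\<^sub>0 int" where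
  "one_plus a = (\<lambda>n. if n = 0 then frag_of [] else if n = 1 then frag_of [a] else 0)"

text \<open>The degree n part of the inverse of 1 + a, namely (-1)^n times the n-fold tensor power
  of a.\<close>

primrec geometric :: "'a \<Rightarrow> nat \<Rightarrow> 'a list \<Rightarrow>\<^sub>0 int" where
  "geometric a 0 = frag_of []"
| "geometric a (Suc n) = - chain_mult (frag_of [a]) (geometric a n)"

lemma series_mult_assoc: "series_mult (series_mult s t) u = series_mult s (series_mult t u)"
proof
  fix n
  have "series_mult (series_mult s t) u n =
      (\<Sum>k\<le>n. \<Sum>j\<le>k. chain_mult (s j) (chain_mult (t (k - j)) (u (n - k))))"
    by (simp add: series_mult_def chain_mult_sum chain_mult_assoc)
  \<comment> \<open>The pairs with j \<le> k \<le> n are renamed (j, k - j), so that the new inner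
    index is the degree of the part taken from t.\<close>
  also have "\<dots> = (\<Sum>j\<le>n. \<Sum>k\<le>n - j. chain_mult (s j) (chain_mult (t k) (u (n - (j + k)))))"
    unfolding sum.Sigma[OF finite_atMost ballI[OF finite_atMost]]
    by (rule sum.reindex_bij_witness[where i = "\<lambda>(j, k). (j + k, j)" and j = "\<lambda>(k, j). (j, k - j)"]) auto
  also have "\<dots> = series_mult s (series_mult t u) n"
    by (simp add: series_mult_def chain_mult_sum)
  finally show "series_mult (series_mult s t) u n = series_mult s (series_mult t u) n" .
qed

lemma series_mult_one: "series_mult series_one s = s" "series_mult s series_one = s"
proof -
  have "chain_mult (series_one k) (s (n - k)) = (if k = 0 then s n else 0)"
    "chain_mult (s k) (series_one (n - k)) = (if k = n then s n else 0)" if "k \<le> n" for k n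
    using that by (auto simp: series_one_def)
  then show "series_mult series_one s = s" "series_mult s series_one = s"
    by (simp_all add: series_mult_def fun_eq_iff)
qed

text \<open>The recursion of \<open>geometric\<close> multiplies by a on the left, whereas the
  product with \<open>one_plus a\<close> as second factor needs a on the right.\<close>

lemma geometric_commute: "chain_mult (geometric a n) (frag_of [a]) = chain_mult (frag_of [a]) (geometric a n)"
proof (induction n)
  case (Suc n)
  have neg: "chain_mult (- p) q = - chain_mult p q" "chain_mult p (- q) = - chain_mult p q"
    for p q :: "'a list \<Rightarrow>\<^sub>0 int"
    using chain_mult_diff(1)[of 0 p q] chain_mult_diff(2)[of p 0 q] by simp_all
  show ?case using Suc by (simp add: neg chain_mult_assoc)
qed simp

text \<open>In positive degree n only two terms of each product survive,
  \<open>geometric a n\<close> and its negative, since \<open>one_plus a\<close> lives in degrees 0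
  and 1.\<close>

lemma one_plus_geometric:
  "series_mult (one_plus a) (geometric a) = series_one"
  "series_mult (geometric a) (one_plus a) = series_one"
proof -
  have "series_mult (one_plus a) (geometric a) n = series_one n \<and>
      series_mult (geometric a) (one_plus a) n = series_one n" for n
  proof (cases n)
    case (Suc m)
    have "chain_mult (one_plus a (Suc k)) (geometric a (m - k)) =
        (if k = 0 then - geometric a n else 0)" for k
      using Suc by (simp add: one_plus_def)
    moreover have "chain_mult (geometric a k) (one_plus a (n - k)) =
        (if k = m then - geometric a n else 0)" if "k \<le> m" for k
      using Suc that by (auto simp: one_plus_def geometric_commute)
    ultimately show ?thesis
      using Suc sum.atMost_Suc_shift[of "\<lambda>k. chain_mult (one_plus a k) (geometric a (n - k))" m]
      by (simp add: series_mult_def one_plus_def series_one_def)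
  qed (simp add: series_mult_def one_plus_def series_one_def)
  then show "series_mult (one_plus a) (geometric a) = series_one"
    "series_mult (geometric a) (one_plus a) = series_one"
    by auto
qed

context comm_group
begin

lemma series_mult_closed: "s \<in> series G \<Longrightarrow> t \<in> series G \<Longrightarrow> series_mult s t \<in> series G"
  unfolding series_def
proof (intro CollectI allI)
  fix n assume st: "s \<in> {s. \<forall>n. Poly_Mapping.keys (s n) \<subseteq> tuples G n}"
    "t \<in> {s. \<forall>n. Poly_Mapping.keys (s n) \<subseteq> tuples G n}"
  have "series_mult s t n \<in> carrier (free_Abelian_group (tuples G n))"
    unfolding series_mult_def
  proof (rule sum_closed_free_Abelian_group)
    fix k assume "k \<in> {..n}"
    then show "chain_mult (s k) (t (n - k)) \<in> carrier (free_Abelian_group (tuples G n))"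
      using st chain_mult_closed[of "s k" G k "t (n - k)" "n - k"] by simp
  qed
  then show "Poly_Mapping.keys (series_mult s t n) \<subseteq> tuples G n" by simp
qed

text \<open>Choosing a representative in every degree lifts an element to a series of chains. The
  monoid laws of the completed algebra then follow from those of \<open>series_mult\<close>.\<close>

lemma carrier_completed_tensor_algebra:
  "carrier (completed_tensor_algebra G) = series_class G ` series G"
proof (intro equalityI subsetI)
  fix t assume "t \<in> carrier (completed_tensor_algebra G)"
  then have "t n \<in> carrier (tensor_power G n)" for n
    by (simp add: completed_tensor_algebra_def)
  then have "\<exists>p. Poly_Mapping.keys p \<subseteq> tuples G n \<and> t n = tensor_class G n p" for n
    unfolding carrier_tensor_power by blast
  then obtain s where "\<And>n. Poly_Mapping.keys (s n) \<subseteq> tuples G n \<and> t n = tensor_class G n (s n)"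
    by metis
  then have "s \<in> series G" "t = series_class G s"
    by (auto simp: series_def series_class_def)
  then show "t \<in> series_class G ` series G" by blast
qed (auto simp: completed_tensor_algebra_def series_class_def series_def)

lemma series_class_mult:
  assumes "s \<in> series G" "t \<in> series G"
  shows "series_class G s \<otimes>\<^bsub>completed_tensor_algebra G\<^esub> series_class G t = series_class G (series_mult s t)"
proof
  fix n
  have clo: "Poly_Mapping.keys (chain_mult (s k) (t (n - k))) \<subseteq> tuples G n" if "k \<in> {..n}" for k
    using that assms chain_mult_closed[of "s k" G k "t (n - k)" "n - k"] by (simp add: series_def)
  interpret T: comm_group "tensor_power G n" by (rule comm_group_tensor_power)
  have "(series_class G s \<otimes>\<^bsub>completed_tensor_algebra G\<^esub> series_class G t) n =
      (\<Otimes>\<^bsub>tensor_power G n\<^esub>k\<in>{..n}. tensor_mult G k (n - k) (tensor_class G k (s k))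
        (tensor_class G (n - k) (t (n - k))))"
    by (simp add: completed_tensor_algebra_def series_class_def)
  also have "\<dots> = (\<Otimes>\<^bsub>tensor_power G n\<^esub>k\<in>{..n}. tensor_class G n (chain_mult (s k) (t (n - k))))"
    using assms clo by (intro T.finprod_cong' refl) (auto simp: series_def tensor_mult_class)
  also have "\<dots> = series_class G (series_mult s t) n"
    unfolding series_class_def series_mult_def by (rule tensor_class_finprod[OF clo]) simp_all
  finally show "(series_class G s \<otimes>\<^bsub>completed_tensor_algebra G\<^esub> series_class G t) n =
    series_class G (series_mult s t) n" .
qed

lemma one_completed_tensor_algebra:
  "\<one>\<^bsub>completed_tensor_algebra G\<^esub> = series_class G series_one"
  by (auto simp: completed_tensor_algebra_def series_class_def series_one_def pure_tensor_def
      tensor_class_zero fun_eq_iff)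

lemma series_one_closed: "series_one \<in> series G"
  by (auto simp: series_def series_one_def)

lemma monoid_completed_tensor_algebra: "monoid (completed_tensor_algebra G)"
  by (rule monoidI)
    (auto simp: carrier_completed_tensor_algebra series_class_mult one_completed_tensor_algebra
      series_mult_closed series_one_closed series_mult_assoc series_mult_one)

lemma one_plus_degree_one:
  assumes "a \<in> carrier G"
  shows "\<one>\<^bsub>completed_tensor_algebra G\<^esub> \<oplus>\<^bsub>completed_tensor_algebra G\<^esub> degree_one G a =
    series_class G (one_plus a)"
proof
  fix n
  interpret T: comm_group "tensor_power G n" by (rule comm_group_tensor_power)
  interpret T0: comm_group "tensor_power G 0" by (rule comm_group_tensor_power)
  interpret T1: comm_group "tensor_power G (Suc 0)" by (rule comm_group_tensor_power)
  show "(\<one>\<^bsub>completed_tensor_algebra G\<^esub> \<oplus>\<^bsub>completed_tensor_algebra G\<^esub> degree_one G a) n =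
    series_class G (one_plus a) n"
    using assms
    by (auto simp: completed_tensor_algebra_def degree_one_def series_class_def one_plus_def
        pure_tensor_def tensor_class_zero)
qed

lemma geometric_closed: "a \<in> carrier G \<Longrightarrow> geometric a \<in> series G"
  unfolding series_def
proof (intro CollectI allI)
  fix n assume "a \<in> carrier G"
  then show "Poly_Mapping.keys (geometric a n) \<subseteq> tuples G n"
    using chain_mult_closed[of "frag_of [a]" G 1 "geometric a k" k for k]
    by (induction n) auto
qed

text \<open>This invertibility is what allows the universal property of the free group to be used
  for the Magnus expansion: the prescribed values lie in a group, the units of the algebra.\<close>

lemma one_plus_degree_one_unit:
  assumes "a \<in> carrier G"
  shows "\<one>\<^bsub>completed_tensor_algebra G\<^esub> \<oplus>\<^bsub>completed_tensor_algebra G\<^esub> degree_one G a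
    \<in> Units (completed_tensor_algebra G)"
proof -
  have "one_plus a \<in> series G" "geometric a \<in> series G"
    using assms geometric_closed by (auto simp: series_def one_plus_def tuples_def)
  then show ?thesis
    using one_plus_geometric[of a] unfolding one_plus_degree_one[OF assms] Units_def
    by (auto simp: carrier_completed_tensor_algebra one_completed_tensor_algebra series_class_mult
      intro!: bexI[of _ "geometric a"])
qed

section \<open>Multiplication in degrees zero, one and two\<close>

lemma tensor_mult_closed:
  assumes "P \<in> carrier (tensor_power G k)" "Q \<in> carrier (tensor_power G l)" "n = k + l"
  shows "tensor_mult G k l P Q \<in> carrier (tensor_power G n)"
  using assms by (auto simp: carrier_tensor_power[of k] carrier_tensor_power[of l] tensor_mult_class
      chain_mult_closed)

lemma tensor_mult_pure:
  "set xs \<subseteq> carrier G \<Longrightarrow> set ys \<subseteq> carrier G \<Longrightarrow> k = length xs \<Longrightarrow> l = length ys \<Longrightarrow>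
    tensor_mult G k l (pure_tensor G xs) (pure_tensor G ys) = pure_tensor G (xs @ ys)"
  by (simp add: pure_tensor_def tensor_mult_class tuples_def)

lemma tensor_mult_pure_Nil:
  assumes "P \<in> carrier (tensor_power G n)"
  shows "tensor_mult G 0 n (pure_tensor G []) P = P" "tensor_mult G n 0 P (pure_tensor G []) = P"
proof -
  obtain p where p: "Poly_Mapping.keys p \<subseteq> tuples G n" "P = tensor_class G n p"
    using assms unfolding carrier_tensor_power by blast
  then show "tensor_mult G 0 n (pure_tensor G []) P = P" "tensor_mult G n 0 P (pure_tensor G []) = P"
    using tensor_mult_class[of "frag_of []" 0 p n] tensor_mult_class[of p n "frag_of []" 0]
    by (simp_all add: pure_tensor_def)
qed

text \<open>With constant terms equal to the unit \<open>pure_tensor G []\<close>, the outer terms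
  of the convolution are the degree n parts of the factors themselves. Degree one is then additive,
  and degree two gains just the cross term of the two degree one parts.\<close>

lemma completed_tensor_algebra_mult:
  assumes s: "s \<in> carrier (completed_tensor_algebra G)" and t: "t \<in> carrier (completed_tensor_algebra G)"
  shows "(s \<otimes>\<^bsub>completed_tensor_algebra G\<^esub> t) 0 = tensor_mult G 0 0 (s 0) (t 0)"
    and "s 0 = pure_tensor G [] \<Longrightarrow> t 0 = pure_tensor G [] \<Longrightarrow>
      (s \<otimes>\<^bsub>completed_tensor_algebra G\<^esub> t) 1 = s 1 \<otimes>\<^bsub>tensor_power G 1\<^esub> t 1"
    and "s 0 = pure_tensor G [] \<Longrightarrow> t 0 = pure_tensor G [] \<Longrightarrow> s 1 = pure_tensor G [a] \<Longrightarrow>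
      t 1 = pure_tensor G [b] \<Longrightarrow> a \<in> carrier G \<Longrightarrow> b \<in> carrier G \<Longrightarrow>
      (s \<otimes>\<^bsub>completed_tensor_algebra G\<^esub> t) 2 =
        s 2 \<otimes>\<^bsub>tensor_power G 2\<^esub> pure_tensor G [a, b] \<otimes>\<^bsub>tensor_power G 2\<^esub> t 2"
proof -
  interpret T0: comm_group "tensor_power G 0" by (rule comm_group_tensor_power)
  interpret T1: comm_group "tensor_power G (Suc 0)" by (rule comm_group_tensor_power)
  interpret T2: comm_group "tensor_power G (Suc (Suc 0))" by (rule comm_group_tensor_power)
  have clo: "s n \<in> carrier (tensor_power G n)" "t n \<in> carrier (tensor_power G n)" for n
    using s t by (simp_all add: completed_tensor_algebra_def)
  have f: "(\<lambda>k. tensor_mult G k (n - k) (s k) (t (n - k))) \<in> {..n} \<rightarrow> carrier (tensor_power G n)" for n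
    using clo by (auto intro: tensor_mult_closed)
  have mult: "(s \<otimes>\<^bsub>completed_tensor_algebra G\<^esub> t) n =
      (\<Otimes>\<^bsub>tensor_power G n\<^esub>k\<in>{..n}. tensor_mult G k (n - k) (s k) (t (n - k)))" for n
    by (simp add: completed_tensor_algebra_def)
  show "(s \<otimes>\<^bsub>completed_tensor_algebra G\<^esub> t) 0 = tensor_mult G 0 0 (s 0) (t 0)"
    using f[of 0] by (simp add: mult)
  show "(s \<otimes>\<^bsub>completed_tensor_algebra G\<^esub> t) 1 = s 1 \<otimes>\<^bsub>tensor_power G 1\<^esub> t 1"
    if "s 0 = pure_tensor G []" "t 0 = pure_tensor G []"
    using f[of 1] that clo[of 1] T1.m_comm
    by (simp add: mult tensor_mult_pure_Nil Pi_iff)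
  show "(s \<otimes>\<^bsub>completed_tensor_algebra G\<^esub> t) 2 =
      s 2 \<otimes>\<^bsub>tensor_power G 2\<^esub> pure_tensor G [a, b] \<otimes>\<^bsub>tensor_power G 2\<^esub> t 2"
    if "s 0 = pure_tensor G []" "t 0 = pure_tensor G []" "s 1 = pure_tensor G [a]"
      "t 1 = pure_tensor G [b]" "a \<in> carrier G" "b \<in> carrier G"
    using f[of 2] that clo[of 2]
    by (simp add: mult tensor_mult_pure_Nil tensor_mult_pure Pi_iff numeral_2_eq_2 T2.m_assoc)
qed

end

section \<open>The Magnus expansion and the Johnson homomorphism\<close>

locale free_group_rank =
  fixes m :: nat
begin

abbreviation F where "F \<equiv> free_group m"
abbreviation H where "H \<equiv> H_ab m"
abbreviation T where "T \<equiv> completed_tensor_algebra H"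
abbreviation T2 where "T2 \<equiv> tensor_power H 2"

sublocale F: group F
  unfolding free_group_def by (rule group_presented_group)

sublocale H: comm_group H
  unfolding H_ab_def by (rule F.derived_quot_is_comm_group)

sublocale T: monoid T
  by (rule H.monoid_completed_tensor_algebra)

sublocale T2: comm_group T2
  by (rule H.comm_group_tensor_power)

lemma x_gen_closed [simp]: "i \<in> {1..m} \<Longrightarrow> x_gen m i \<in> carrier F"
  by (simp add: x_gen_def free_group_def pres_class_closed)

lemma free_group_hom_exists:
  assumes "group A" "f \<in> {1..m} \<rightarrow> carrier A"
  obtains h where "h \<in> hom F A" "h \<in> extensional (carrier F)" "\<And>i. i \<in> {1..m} \<Longrightarrow> h (x_gen m i) = f i"
proof -
  interpret A: group A by fact
  obtain h where "h \<in> hom F A" "h \<in> extensional (carrier F)"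
    "\<And>w. w \<in> words {1..m} \<Longrightarrow> h (pres_class {1..m} {} w) = word_eval A f w"
    using A.presented_group_hom_exists[OF assms(2), of "{}"] unfolding free_group_def by blast
  moreover have "word_eval A f [(i, True)] = f i" if "i \<in> {1..m}" for i
    using funcset_mem[OF assms(2) that] by simp
  ultimately show thesis using that by (simp add: x_gen_def)
qed

lemma free_group_hom_eq:
  assumes "group A" "h \<in> hom F A" "h' \<in> hom F A"
    and "\<And>i. i \<in> {1..m} \<Longrightarrow> h (x_gen m i) = h' (x_gen m i)" "x \<in> carrier F"
  shows "h x = h' x"
  using group.presented_group_hom_eq[OF assms(1), of h "{1..m}" "{}" h' x] assms
  by (simp add: free_group_def x_gen_def)

lemma group_hom_F: "group A \<Longrightarrow> h \<in> hom F A \<Longrightarrow> group_hom F A h"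
  by (simp add: group_hom_def group_hom_axioms_def)

lemma ab_class_hom: "ab_class m \<in> hom F H"
proof -
  have "derived F (carrier F) \<lhd> F"
    by (rule F.derived_self_is_normal)
  from normal.r_coset_hom_Mod[OF this] show ?thesis
    unfolding ab_class_def[abs_def] H_ab_def .
qed

lemma ab_class_closed [simp]: "x \<in> carrier F \<Longrightarrow> ab_class m x \<in> carrier H"
  using ab_class_hom by (auto simp: hom_def)

lemma ab_class_mult [simp]:
  "x \<in> carrier F \<Longrightarrow> y \<in> carrier F \<Longrightarrow> ab_class m (x \<otimes>\<^bsub>F\<^esub> y) = ab_class m x \<otimes>\<^bsub>H\<^esub> ab_class m y"
  using ab_class_hom by (auto simp: hom_def)

lemma ab_class_inv [simp]:
  "x \<in> carrier F \<Longrightarrow> ab_class m (inv\<^bsub>F\<^esub> x) = inv\<^bsub>H\<^esub> ab_class m x"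
  by (rule group_hom.hom_inv[OF group_hom_F[OF H.is_group ab_class_hom]])

lemma carrier_H: "carrier H = ab_class m ` carrier F"
  unfolding H_ab_def carrier_FactGroup ab_class_def[abs_def] by simp

lemma X_gen_closed [simp]: "i \<in> {1..m} \<Longrightarrow> X_gen m i \<in> carrier H"
  by (simp add: X_gen_def)

text \<open>Elements of one coset differ by an element of the derived subgroup, whose image lies in
  the derived subgroup of a commutative group and is therefore trivial.\<close>

lemma hom_ab_class_cong:
  assumes "comm_group A" "h \<in> hom F A" "x \<in> ab_class m y" "y \<in> carrier F"
  shows "h x = h y"
proof -
  interpret A: comm_group A by fact
  interpret h: group_hom F A h by (rule group_hom_F[OF A.is_group assms(2)])
  obtain d where d: "d \<in> derived F (carrier F)" "x = d \<otimes>\<^bsub>F\<^esub> y"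
    using assms(3) by (auto simp: ab_class_def r_coset_def)
  have "h d \<in> derived A (h ` carrier F)"
    using d(1) h.derived_img[of "carrier F"] by auto
  also have "\<dots> = {\<one>\<^bsub>A\<^esub>}" by (rule A.derived_eq_singleton) auto
  finally show ?thesis
    using d assms(4) F.derived_in_carrier[of "carrier F"] by auto
qed

lemma ab_class_self: "x \<in> carrier F \<Longrightarrow> x \<in> ab_class m x"
  using F.rcos_self[OF _ F.derived_is_subgroup[OF order.refl]] by (simp add: ab_class_def)

lemma hom_ab_class_eq:
  assumes "comm_group A" "h \<in> hom F A" "x \<in> carrier F" "y \<in> carrier F" "ab_class m x = ab_class m y"
  shows "h x = h y"
  using hom_ab_class_cong[OF assms(1,2) _ assms(4)] ab_class_self[OF assms(3)] assms(5) by simp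

lemma H_hom_eq:
  assumes "comm_group A" "h \<in> hom H A" "h' \<in> hom H A"
    and "\<And>i. i \<in> {1..m} \<Longrightarrow> h (X_gen m i) = h' (X_gen m i)" "x \<in> carrier H"
  shows "h x = h' x"
proof -
  obtain y where y: "y \<in> carrier F" "x = ab_class m y" using assms(5) by (auto simp: carrier_H)
  have "(h \<circ> ab_class m) y = (h' \<circ> ab_class m) y"
  proof (rule free_group_hom_eq[OF _ _ _ _ y(1)])
    show "group A" using assms(1) by (simp add: comm_group_def)
    show "h \<circ> ab_class m \<in> hom F A" "h' \<circ> ab_class m \<in> hom F A"
      by (fact hom_compose[OF ab_class_hom assms(2)] hom_compose[OF ab_class_hom assms(3)])+
  qed (use assms(4) in \<open>simp add: X_gen_def\<close>)
  then show ?thesis using y by simp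
qed

subsection \<open>The Magnus expansion in low degrees\<close>

definition is_magnus :: "(nat word set \<Rightarrow> nat \<Rightarrow> nat word set set tensor) \<Rightarrow> bool" where
  "is_magnus \<theta> \<longleftrightarrow> \<theta> \<in> carrier F \<rightarrow>\<^sub>E carrier T \<and> \<theta> \<one>\<^bsub>F\<^esub> = \<one>\<^bsub>T\<^esub> \<and>
     (\<forall>x\<in>carrier F. \<forall>y\<in>carrier F. \<theta> (x \<otimes>\<^bsub>F\<^esub> y) = \<theta> x \<otimes>\<^bsub>T\<^esub> \<theta> y) \<and>
     (\<forall>i\<in>{1..m}. \<theta> (x_gen m i) = \<one>\<^bsub>T\<^esub> \<oplus>\<^bsub>T\<^esub> degree_one H (X_gen m i))"

text \<open>Any multiplicative \<theta> with \<theta>(1) = 1 has unit values, because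
  \<theta>(x\<inverse>) is inverse to \<theta>(x). Competing expansions thus become homomorphisms to
  one group, where agreement on generators suffices.\<close>

lemma is_magnus_hom_units:
  assumes "is_magnus \<theta>"
  shows "\<theta> \<in> hom F (units_of T)"
proof (rule homI)
  have \<theta>: "\<And>x. x \<in> carrier F \<Longrightarrow> \<theta> x \<in> carrier T" "\<theta> \<one>\<^bsub>F\<^esub> = \<one>\<^bsub>T\<^esub>"
    "\<And>x y. x \<in> carrier F \<Longrightarrow> y \<in> carrier F \<Longrightarrow> \<theta> (x \<otimes>\<^bsub>F\<^esub> y) = \<theta> x \<otimes>\<^bsub>T\<^esub> \<theta> y"
    using assms by (auto simp: is_magnus_def)
  fix x assume x: "x \<in> carrier F"
  have "\<theta> (inv\<^bsub>F\<^esub> x) \<otimes>\<^bsub>T\<^esub> \<theta> x = \<one>\<^bsub>T\<^esub>" "\<theta> x \<otimes>\<^bsub>T\<^esub> \<theta> (inv\<^bsub>F\<^esub> x) = \<one>\<^bsub>T\<^esub>"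
    using x \<theta>(2) by (simp_all flip: \<theta>(3))
  then show "\<theta> x \<in> carrier (units_of T)"
    using x \<theta>(1)[of x] \<theta>(1)[of "inv\<^bsub>F\<^esub> x"] by (auto simp: units_of_carrier Units_def)
  fix y assume "y \<in> carrier F"
  then show "\<theta> (x \<otimes>\<^bsub>F\<^esub> y) = \<theta> x \<otimes>\<^bsub>units_of T\<^esub> \<theta> y"
    using x \<theta>(3) by (simp add: units_of_mult)
qed

text \<open>Existence is the universal property of the free group with values in the units of
  \<open>T\<close>; uniqueness is the comparison on generators of two homomorphisms into these
  units.\<close>

lemma is_magnus_magnus: "is_magnus (magnus m)"
proof -
  obtain h where h: "h \<in> hom F (units_of T)" "h \<in> extensional (carrier F)"
    "\<And>i. i \<in> {1..m} \<Longrightarrow> h (x_gen m i) = \<one>\<^bsub>T\<^esub> \<oplus>\<^bsub>T\<^esub> degree_one H (X_gen m i)"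
    using free_group_hom_exists[OF T.units_group, of "\<lambda>i. \<one>\<^bsub>T\<^esub> \<oplus>\<^bsub>T\<^esub> degree_one H (X_gen m i)"]
      H.one_plus_degree_one_unit
    by (auto simp: units_of_carrier Pi_iff)
  have "is_magnus h"
    unfolding is_magnus_def
    using h group_hom.hom_one[OF group_hom_F[OF T.units_group h(1)]]
    by (auto simp: hom_def units_of_carrier units_of_mult units_of_one PiE_def Pi_iff)
  moreover have "\<theta> = h" if "is_magnus \<theta>" for \<theta>
  proof (rule extensionalityI)
    show "\<theta> \<in> extensional (carrier F)" using that by (auto simp: is_magnus_def PiE_def)
    show "\<theta> x = h x" if "x \<in> carrier F" for x
      by (rule free_group_hom_eq[OF T.units_group is_magnus_hom_units[OF \<open>is_magnus \<theta>\<close>] h(1) _ that])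
        (use \<open>is_magnus \<theta>\<close> h(3) in \<open>simp add: is_magnus_def\<close>)
  qed (fact h(2))
  ultimately have "is_magnus (THE \<theta>. is_magnus \<theta>)" by (rule theI)
  then show ?thesis by (simp add: magnus_def is_magnus_def[abs_def] Let_def)
qed

lemma magnus_closed: "x \<in> carrier F \<Longrightarrow> magnus m x \<in> carrier T"
  using is_magnus_magnus by (auto simp: is_magnus_def)

lemma magnus_closed_degree [simp]: "x \<in> carrier F \<Longrightarrow> magnus m x n \<in> carrier (tensor_power H n)"
  using magnus_closed by (simp add: completed_tensor_algebra_def)

lemma magnus_mult:
  "x \<in> carrier F \<Longrightarrow> y \<in> carrier F \<Longrightarrow> magnus m (x \<otimes>\<^bsub>F\<^esub> y) = magnus m x \<otimes>\<^bsub>T\<^esub> magnus m y"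
  using is_magnus_magnus by (simp add: is_magnus_def)

lemma magnus_gen:
  assumes "i \<in> {1..m}"
  shows "magnus m (x_gen m i) 0 = pure_tensor H []" "magnus m (x_gen m i) 1 = pure_tensor H [X_gen m i]"
    "magnus m (x_gen m i) 2 = \<one>\<^bsub>T2\<^esub>"
proof -
  have "magnus m (x_gen m i) = series_class H (one_plus (X_gen m i))"
    using is_magnus_magnus assms by (simp add: is_magnus_def H.one_plus_degree_one)
  then show "magnus m (x_gen m i) 0 = pure_tensor H []"
    "magnus m (x_gen m i) 1 = pure_tensor H [X_gen m i]" "magnus m (x_gen m i) 2 = \<one>\<^bsub>T2\<^esub>"
    by (simp_all add: series_class_def one_plus_def pure_tensor_def H.tensor_class_zero)
qed

lemma magnus_one: "magnus m \<one>\<^bsub>F\<^esub> 0 = pure_tensor H []" "magnus m \<one>\<^bsub>F\<^esub> 2 = \<one>\<^bsub>T2\<^esub>"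
  using is_magnus_magnus by (simp_all add: is_magnus_def completed_tensor_algebra_def)

text \<open>The group operation of \<open>tensor_power H 0\<close> is addition, while \<theta>_0 is
  multiplicative for \<open>tensor_mult\<close>. Comparison of homomorphisms into that group is
  therefore replaced by induction on the element.\<close>

lemma magnus_0: "x \<in> carrier F \<Longrightarrow> magnus m x 0 = pure_tensor H []"
  unfolding free_group_def
proof (induction rule: presented_group_induct)
  case one
  then show ?case using magnus_one by (simp add: free_group_def)
next
  case (gen g y)
  then have g: "x_gen m g \<in> carrier F" "y \<in> carrier F"
    using x_gen_closed by (simp_all only: free_group_def)
  show ?case
    using gen magnus_gen(1)[OF gen(1)] g
      H.completed_tensor_algebra_mult(1)[OF magnus_closed[OF g(1)] magnus_closed[OF g(2)]]
    by (simp add: magnus_mult H.tensor_mult_pure del: One_nat_def flip: x_gen_def free_group_def)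
next
  case (inv g y)
  then have g: "x_gen m g \<in> carrier F" "y \<in> carrier F"
    using x_gen_closed by (simp_all only: free_group_def)
  then have g': "inv\<^bsub>F\<^esub> x_gen m g \<in> carrier F" by simp
  \<comment> \<open>The factor \<theta>_0 of the generator is the unit and may be inserted;
    multiplicativity then turns the product into \<theta>_0(1).\<close>
  have "magnus m (inv\<^bsub>F\<^esub> x_gen m g) 0 = tensor_mult H 0 0 (magnus m (inv\<^bsub>F\<^esub> x_gen m g) 0) (magnus m (x_gen m g) 0)"
    using g' magnus_gen(1)[OF inv(1)] by (simp add: H.tensor_mult_pure_Nil)
  also have "\<dots> = magnus m \<one>\<^bsub>F\<^esub> 0"
    using H.completed_tensor_algebra_mult(1)[OF magnus_closed[OF g'] magnus_closed[OF g(1)]] g g'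
    by (simp flip: magnus_mult)
  finally have "magnus m (inv\<^bsub>F\<^esub> x_gen m g) 0 = pure_tensor H []" by (simp add: magnus_one)
  then show ?case
    using inv g g' H.completed_tensor_algebra_mult(1)[OF magnus_closed[OF g'] magnus_closed[OF g(2)]]
    by (simp add: magnus_mult H.tensor_mult_pure del: One_nat_def flip: x_gen_def free_group_def)
qed

text \<open>Once all constant terms are the unit, the degree one part is a homomorphism to
  \<open>tensor_power H 1\<close>, and so is the right-hand side; they agree on the
  generators.\<close>

lemma magnus_1: "x \<in> carrier F \<Longrightarrow> magnus m x 1 = pure_tensor H [ab_class m x]"
proof (rule free_group_hom_eq[where h = "\<lambda>x. magnus m x 1" and h' = "\<lambda>x. pure_tensor H [ab_class m x]"])
  show "group (tensor_power H 1)"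
    using H.comm_group_tensor_power by (simp add: comm_group_def)
  show "(\<lambda>x. magnus m x 1) \<in> hom F (tensor_power H 1)"
    using H.completed_tensor_algebra_mult(2)[OF magnus_closed magnus_closed]
    by (intro homI) (simp_all add: magnus_mult magnus_0)
  show "(\<lambda>x. pure_tensor H [ab_class m x]) \<in> hom F (tensor_power H 1)"
    using H.pure_tensor_mult[of "[]" "[]"] by (intro homI) simp_all
qed (use magnus_gen in \<open>simp_all add: X_gen_def\<close>)

lemma magnus_2_mult:
  assumes "x \<in> carrier F" "y \<in> carrier F"
  shows "magnus m (x \<otimes>\<^bsub>F\<^esub> y) 2 =
    magnus m x 2 \<otimes>\<^bsub>T2\<^esub> pure_tensor H [ab_class m x, ab_class m y] \<otimes>\<^bsub>T2\<^esub> magnus m y 2"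
  using assms by (simp add: magnus_mult H.completed_tensor_algebra_mult(3)[OF magnus_closed magnus_closed]
      magnus_0 magnus_1[simplified])

subsection \<open>Automorphisms and the Johnson homomorphism\<close>

lemma carrier_AutoGroup [simp]: "carrier (AutoGroup F) = auto F"
  by (simp add: AutoGroup_def)

sublocale Aut: group "AutoGroup F"
  by (rule F.AutoGroup)

lemma auto_hom: "\<phi> \<in> auto F \<Longrightarrow> \<phi> \<in> hom F F"
  by (simp add: auto_def)

lemma auto_closed [simp]: "\<phi> \<in> auto F \<Longrightarrow> x \<in> carrier F \<Longrightarrow> \<phi> x \<in> carrier F"
  by (auto simp: auto_def hom_def)

lemma Aut_mult: "\<phi> \<in> auto F \<Longrightarrow> \<psi> \<in> auto F \<Longrightarrow> x \<in> carrier F \<Longrightarrow> (\<phi> \<otimes>\<^bsub>AutoGroup F\<^esub> \<psi>) x = \<phi> (\<psi> x)"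
  by (simp add: AutoGroup_def BijGroup_def auto_def compose_eq)

lemma Aut_one: "x \<in> carrier F \<Longrightarrow> \<one>\<^bsub>AutoGroup F\<^esub> x = x"
  by (simp add: AutoGroup_def BijGroup_def)

lemma Aut_inv_closed [simp]: "\<phi> \<in> auto F \<Longrightarrow> inv\<^bsub>AutoGroup F\<^esub> \<phi> \<in> auto F"
  using Aut.inv_closed[of \<phi>] by simp

lemma Aut_inv:
  assumes "\<phi> \<in> auto F" "x \<in> carrier F"
  shows "\<phi> ((inv\<^bsub>AutoGroup F\<^esub> \<phi>) x) = x" "(inv\<^bsub>AutoGroup F\<^esub> \<phi>) (\<phi> x) = x"
proof -
  have "\<phi> ((inv\<^bsub>AutoGroup F\<^esub> \<phi>) x) = (\<phi> \<otimes>\<^bsub>AutoGroup F\<^esub> inv\<^bsub>AutoGroup F\<^esub> \<phi>) x"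
    by (simp only: Aut_mult Aut_inv_closed assms)
  also have "\<dots> = x" using Aut.r_inv[of \<phi>] assms by (simp only: carrier_AutoGroup Aut_one)
  finally show "\<phi> ((inv\<^bsub>AutoGroup F\<^esub> \<phi>) x) = x" .
  have "(inv\<^bsub>AutoGroup F\<^esub> \<phi>) (\<phi> x) = (inv\<^bsub>AutoGroup F\<^esub> \<phi> \<otimes>\<^bsub>AutoGroup F\<^esub> \<phi>) x"
    by (simp only: Aut_mult Aut_inv_closed assms)
  also have "\<dots> = x" using Aut.l_inv[of \<phi>] assms by (simp only: carrier_AutoGroup Aut_one)
  finally show "(inv\<^bsub>AutoGroup F\<^esub> \<phi>) (\<phi> x) = x" .
qed

text \<open>The description in \<open>ab_map\<close> is met because \<open>ab_class m\<close> after
  \<phi> is a homomorphism to a commutative group, hence constant on each coset.\<close>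

lemma ab_map_ab_class:
  assumes "\<phi> \<in> hom F F" "x \<in> carrier F"
  shows "ab_map m \<phi> (ab_class m x) = ab_class m (\<phi> x)"
proof -
  have "(ab_class m \<circ> \<phi>) y = (ab_class m \<circ> \<phi>) x" if "y \<in> ab_class m x" for y
    using hom_ab_class_cong[OF H.comm_group_axioms hom_compose[OF assms(1) ab_class_hom] that assms(2)] .
  then have "(THE h'. \<forall>y\<in>ab_class m x. h' = ab_class m (\<phi> y)) = ab_class m (\<phi> x)"
    using ab_class_self[OF assms(2)] unfolding o_apply by (intro the_equality) blast+
  then show ?thesis using assms by (simp add: ab_map_def)
qed

lemma ab_map_hom:
  assumes "\<phi> \<in> hom F F"
  shows "ab_map m \<phi> \<in> hom H H"
proof (rule homI)
  have clo: "\<phi> x \<in> carrier F" if "x \<in> carrier F" for x using that assms by (auto simp: hom_def)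
  fix a assume "a \<in> carrier H"
  then obtain x where x: "x \<in> carrier F" "a = ab_class m x" by (auto simp: carrier_H)
  then show "ab_map m \<phi> a \<in> carrier H" using assms clo by (simp add: ab_map_ab_class)
  fix b assume "b \<in> carrier H"
  then obtain y where y: "y \<in> carrier F" "b = ab_class m y" by (auto simp: carrier_H)
  have "ab_map m \<phi> (ab_class m (x \<otimes>\<^bsub>F\<^esub> y)) = ab_map m \<phi> (ab_class m x) \<otimes>\<^bsub>H\<^esub> ab_map m \<phi> (ab_class m y)"
    using x y assms clo hom_mult[OF assms] by (simp add: ab_map_ab_class del: ab_class_mult) simp
  then show "ab_map m \<phi> (a \<otimes>\<^bsub>H\<^esub> b) = ab_map m \<phi> a \<otimes>\<^bsub>H\<^esub> ab_map m \<phi> b"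
    using x y by simp
qed

text \<open>The expression under the description in \<open>johnson\<close>, taken at an element of
  \<open>F\<close> before it is known to depend only on the class of that element.\<close>

definition johnson_lift :: "(nat word set \<Rightarrow> nat word set) \<Rightarrow> nat word set \<Rightarrow> nat word set set tensor" where
  "johnson_lift \<phi> x = magnus m x 2 \<otimes>\<^bsub>T2\<^esub>
     inv\<^bsub>T2\<^esub> tensor_map H (ab_map m \<phi>) 2 (magnus m ((inv\<^bsub>AutoGroup F\<^esub> \<phi>) x) 2)"

lemma tensor_map_closed [simp]:
  "f \<in> hom H H \<Longrightarrow> P \<in> carrier (tensor_power H n) \<Longrightarrow> tensor_map H f n P \<in> carrier (tensor_power H n)"
  using H.tensor_map_hom[of f n] by (auto simp: hom_def)

lemma johnson_lift_hom:
  assumes "\<phi> \<in> auto F"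
  shows "johnson_lift \<phi> \<in> hom F T2"
proof (rule homI)
  let ?\<psi> = "inv\<^bsub>AutoGroup F\<^esub> \<phi>" and ?t = "tensor_map H (ab_map m \<phi>) 2"
  note \<phi> = ab_map_hom[OF auto_hom[OF assms]]
  fix x assume x: "x \<in> carrier F"
  show "johnson_lift \<phi> x \<in> carrier T2" using x assms \<phi> by (simp add: johnson_lift_def)
  fix y assume y: "y \<in> carrier F"
  have \<psi>: "?\<psi> x \<in> carrier F" "?\<psi> y \<in> carrier F" "?\<psi> (x \<otimes>\<^bsub>F\<^esub> y) = ?\<psi> x \<otimes>\<^bsub>F\<^esub> ?\<psi> y"
    using x y assms hom_mult[OF auto_hom[OF Aut_inv_closed[OF assms]]] by simp_all
  \<comment> \<open>This is why the mixed terms cancel: |\<phi>| undoes the effect of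
    \<phi>\<inverse> on classes, so the subtracted mixed term is again [x] \<otimes> [y].\<close>
  have ab: "ab_map m \<phi> (ab_class m (?\<psi> z)) = ab_class m z" if "z \<in> carrier F" for z
    using that assms by (simp add: ab_map_ab_class auto_hom Aut_inv)
  have "?t (magnus m (?\<psi> (x \<otimes>\<^bsub>F\<^esub> y)) 2) =
      ?t (magnus m (?\<psi> x) 2) \<otimes>\<^bsub>T2\<^esub> pure_tensor H [ab_class m x, ab_class m y] \<otimes>\<^bsub>T2\<^esub> ?t (magnus m (?\<psi> y) 2)"
    using x y \<psi> \<phi> ab
    by (simp add: magnus_2_mult hom_mult[OF H.tensor_map_hom[OF \<phi>]] H.tensor_map_pure)
  moreover have "a \<otimes>\<^bsub>T2\<^esub> c \<otimes>\<^bsub>T2\<^esub> b \<otimes>\<^bsub>T2\<^esub> inv\<^bsub>T2\<^esub> (a' \<otimes>\<^bsub>T2\<^esub> c \<otimes>\<^bsub>T2\<^esub> b') =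
      a \<otimes>\<^bsub>T2\<^esub> inv\<^bsub>T2\<^esub> a' \<otimes>\<^bsub>T2\<^esub> (b \<otimes>\<^bsub>T2\<^esub> inv\<^bsub>T2\<^esub> b')"
    if "a \<in> carrier T2" "b \<in> carrier T2" "c \<in> carrier T2" "a' \<in> carrier T2" "b' \<in> carrier T2"
    for a b c a' b'
  proof -
    have "c \<otimes>\<^bsub>T2\<^esub> (inv\<^bsub>T2\<^esub> c \<otimes>\<^bsub>T2\<^esub> z) = z" if "z \<in> carrier T2" for z
      using that \<open>c \<in> carrier T2\<close> by (simp flip: T2.m_assoc)
    then show ?thesis using that by (simp add: T2.inv_mult T2.m_ac)
  qed
  ultimately show "johnson_lift \<phi> (x \<otimes>\<^bsub>F\<^esub> y) = johnson_lift \<phi> x \<otimes>\<^bsub>T2\<^esub> johnson_lift \<phi> y"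
    using x y \<psi>(1,2) \<phi> by (simp add: johnson_lift_def magnus_2_mult)
qed

lemma johnson_ab_class:
  assumes "\<phi> \<in> auto F" "x \<in> carrier F"
  shows "johnson m \<phi> (ab_class m x) = johnson_lift \<phi> x"
proof -
  have "johnson_lift \<phi> y = johnson_lift \<phi> x" if "y \<in> carrier F" "ab_class m y = ab_class m x" for y
    using hom_ab_class_eq[OF T2.comm_group_axioms johnson_lift_hom[OF assms(1)] that(1) assms(2) that(2)] .
  then have "(THE t. \<forall>y\<in>carrier F. ab_class m y = ab_class m x \<longrightarrow> t = johnson_lift \<phi> y) = johnson_lift \<phi> x"
    using assms(2) by (intro the_equality) blast+
  then show ?thesis using assms(2) by (simp add: johnson_def Let_def johnson_lift_def)
qed

lemma johnson_hom:
  assumes "\<phi> \<in> auto F"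
  shows "johnson m \<phi> \<in> hom H T2"
proof (rule homI)
  note J = johnson_lift_hom[OF assms]
  fix a assume "a \<in> carrier H"
  then obtain x where x: "x \<in> carrier F" "a = ab_class m x" by (auto simp: carrier_H)
  then show "johnson m \<phi> a \<in> carrier T2"
    using assms hom_in_carrier[OF J] by (simp add: johnson_ab_class)
  fix b assume "b \<in> carrier H"
  then obtain y where y: "y \<in> carrier F" "b = ab_class m y" by (auto simp: carrier_H)
  have "johnson m \<phi> (ab_class m (x \<otimes>\<^bsub>F\<^esub> y)) = johnson m \<phi> (ab_class m x) \<otimes>\<^bsub>T2\<^esub> johnson m \<phi> (ab_class m y)"
    using x y assms by (simp add: johnson_ab_class hom_mult[OF J] del: ab_class_mult)
  then show "johnson m \<phi> (a \<otimes>\<^bsub>H\<^esub> b) = johnson m \<phi> a \<otimes>\<^bsub>T2\<^esub> johnson m \<phi> b"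
    using x y by simp
qed

lemma johnson_extensional: "johnson m \<phi> \<in> extensional (carrier H)"
  by (simp add: johnson_def Let_def)

text \<open>A telescoping sum: |\<phi>| applied to \<theta>_2(\<phi>\<inverse> x) is subtracted by
  the first summand and added by the second, leaving \<theta>_2(x) and the term in
  \<psi>\<inverse>(\<phi>\<inverse> x).\<close>

lemma johnson_mult:
  assumes "\<phi> \<in> auto F" "\<psi> \<in> auto F" "x \<in> carrier F"
  shows "johnson m (\<phi> \<otimes>\<^bsub>AutoGroup F\<^esub> \<psi>) (ab_class m x) = johnson m \<phi> (ab_class m x) \<otimes>\<^bsub>T2\<^esub>
    tensor_map H (ab_map m \<phi>) 2 (johnson m \<psi> (ab_class m ((inv\<^bsub>AutoGroup F\<^esub> \<phi>) x)))"
proof -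
  let ?\<phi> = "inv\<^bsub>AutoGroup F\<^esub> \<phi>" and ?\<psi> = "inv\<^bsub>AutoGroup F\<^esub> \<psi>"
  let ?f = "tensor_map H (ab_map m \<phi>) 2" and ?g = "tensor_map H (ab_map m \<psi>) 2"
  have mult: "\<phi> \<otimes>\<^bsub>AutoGroup F\<^esub> \<psi> \<in> auto F" using Aut.m_closed assms by simp
  note h = ab_map_hom[OF auto_hom[OF assms(1)]] ab_map_hom[OF auto_hom[OF assms(2)]]
    ab_map_hom[OF auto_hom[OF mult]]
  have inv: "(inv\<^bsub>AutoGroup F\<^esub> (\<phi> \<otimes>\<^bsub>AutoGroup F\<^esub> \<psi>)) x = ?\<psi> (?\<phi> x)"
    using assms by (simp add: Aut.inv_mult_group Aut_mult)
  have clo: "?\<phi> x \<in> carrier F" "?\<psi> (?\<phi> x) \<in> carrier F" using assms by simp_all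
  \<comment> \<open>Functoriality of |.| is claimed on the carrier only, which is what
    \<open>tensor_map_cong\<close> asks for.\<close>
  have ab: "ab_map m (\<phi> \<otimes>\<^bsub>AutoGroup F\<^esub> \<psi>) a = (ab_map m \<phi> \<circ> ab_map m \<psi>) a" if a: "a \<in> carrier H" for a
  proof -
    obtain y where "y \<in> carrier F" "a = ab_class m y" using a by (auto simp: carrier_H)
    then show ?thesis using assms mult by (simp add: ab_map_ab_class auto_hom Aut_mult)
  qed
  have "tensor_map H (ab_map m (\<phi> \<otimes>\<^bsub>AutoGroup F\<^esub> \<psi>)) 2 P = ?f (?g P)" if "P \<in> carrier T2" for P
    using H.tensor_map_cong[OF h(3) hom_compose[OF h(2,1)] ab that] H.tensor_map_compose[OF h(1,2) that]
    by (simp add: o_def)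
  then have 1: "johnson m (\<phi> \<otimes>\<^bsub>AutoGroup F\<^esub> \<psi>) (ab_class m x) =
      magnus m x 2 \<otimes>\<^bsub>T2\<^esub> inv\<^bsub>T2\<^esub> ?f (?g (magnus m (?\<psi> (?\<phi> x)) 2))"
    using assms(3) mult clo by (simp add: johnson_ab_class johnson_lift_def inv)
  interpret f: group_hom T2 T2 ?f
    using H.tensor_map_hom[OF h(1)] by (simp add: group_hom_def group_hom_axioms_def)
  have 2: "?f (johnson m \<psi> (ab_class m (?\<phi> x))) =
      ?f (magnus m (?\<phi> x) 2) \<otimes>\<^bsub>T2\<^esub> inv\<^bsub>T2\<^esub> ?f (?g (magnus m (?\<psi> (?\<phi> x)) 2))"
    using assms clo h by (simp add: johnson_ab_class johnson_lift_def)
  have "a \<otimes>\<^bsub>T2\<^esub> inv\<^bsub>T2\<^esub> b \<otimes>\<^bsub>T2\<^esub> (b \<otimes>\<^bsub>T2\<^esub> c) = a \<otimes>\<^bsub>T2\<^esub> c"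
    if "a \<in> carrier T2" "b \<in> carrier T2" "c \<in> carrier T2" for a b c
  proof -
    have "inv\<^bsub>T2\<^esub> b \<otimes>\<^bsub>T2\<^esub> (b \<otimes>\<^bsub>T2\<^esub> c) = c"
      using that by (simp flip: T2.m_assoc)
    then show ?thesis using that by (simp add: T2.m_assoc)
  qed
  then show ?thesis
    unfolding 1 2 using assms clo h by (simp add: johnson_ab_class johnson_lift_def)
qed

end

section \<open>The crossing matrix\<close>

definition letter_crossing :: "nat \<Rightarrow> bool \<Rightarrow> nat \<Rightarrow> nat \<Rightarrow> int" where
  "letter_crossing k e i j =
     (if e then (if i = k + 1 \<and> j = k then 1 else 0) else (if i = k \<and> j = k + 1 then -1 else 0))"

fun bottom_position :: "nat word \<Rightarrow> nat \<Rightarrow> nat" where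
  "bottom_position [] i = i"
| "bottom_position ((k, e) # w) i = bottom_position w (transpose k (k + 1) i)"

text \<open>The names of the strings are mere labels. The effect of a first letter can therefore be
  treated as a renaming of the strings of the remaining diagram.\<close>

lemma crossings_comp: "crossings (f \<circ> s) w = map (\<lambda>(a, b, e). (f a, f b, e)) (crossings s w)"
proof (induction s w rule: crossings.induct)
  case (2 s k w)
  have eq: "(f \<circ> s)(k := (f \<circ> s) (k + 1), k + 1 := (f \<circ> s) k) = f \<circ> s(k := s (k + 1), k + 1 := s k)"
    by auto
  show ?case unfolding crossings.simps eq 2 by simp
next
  case (3 s k w)
  have eq: "(f \<circ> s)(k := (f \<circ> s) (k + 1), k + 1 := (f \<circ> s) k) = f \<circ> s(k := s (k + 1), k + 1 := s k)"
    by auto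
  show ?case unfolding crossings.simps eq 3 by simp
qed simp

lemma crossing_matrix_of_diagram_Nil [simp]: "crossing_matrix_of_diagram [] i j = 0"
  by (simp add: crossing_matrix_of_diagram_def)

text \<open>Below the first letter, string i sits at its transposed position and counts as the
  string of that number for \<open>w\<close>. Since the transposition is an involution, the same map
  also translates names back.\<close>

lemma crossing_matrix_of_diagram_Cons:
  "crossing_matrix_of_diagram ((k, e) # w) i j = letter_crossing k e i j +
     crossing_matrix_of_diagram w (transpose k (k + 1) i) (transpose k (k + 1) j)"
proof -
  let ?t = "transpose k (k + 1)"
  have "id(k := id (k + 1), k + 1 := id k) = ?t \<circ> id"
    by (auto simp: transpose_def)
  then have c: "crossings (id(k := id (k + 1), k + 1 := id k)) w =
      map (\<lambda>(a, b, e). (?t a, ?t b, e)) (crossings id w)"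
    using crossings_comp[of ?t id w] by simp
  have "?t a = i \<longleftrightarrow> a = ?t i" for a i
    by (metis transpose_involutory)
  then have "(\<Sum>(a, b, e) \<leftarrow> map (\<lambda>(a, b, e). (?t a, ?t b, e)) (crossings id w). if a = i \<and> b = j then e else 0)
      = crossing_matrix_of_diagram w (?t i) (?t j)"
    by (simp add: crossing_matrix_of_diagram_def o_def case_prod_unfold cong: if_cong)
  then show ?thesis
    using c by (cases e) (auto simp: crossing_matrix_of_diagram_def letter_crossing_def)
qed

lemma crossing_matrix_of_diagram_append:
  "crossing_matrix_of_diagram (u @ v) i j = crossing_matrix_of_diagram u i j +
     crossing_matrix_of_diagram v (bottom_position u i) (bottom_position u j)"
proof (induction u arbitrary: i j)
  case (Cons x u)
  then show ?case by (cases x) (simp add: crossing_matrix_of_diagram_Cons)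
qed simp

text \<open>Moves a transposition from the variable indices of a matrix entry to the concrete ones
  of a letter, where it can be evaluated.\<close>

lemma transpose_eq_iff': "transpose p q a = c \<longleftrightarrow> a = transpose p q c"
  by (metis transpose_involutory)

lemma crossings_braid:
  "bottom_position [(i, True), (Suc i, True), (i, True)] =
     bottom_position [(Suc i, True), (i, True), (Suc i, True)]"
  "crossing_matrix_of_diagram [(i, True), (Suc i, True), (i, True)] =
     crossing_matrix_of_diagram [(Suc i, True), (i, True), (Suc i, True)]"
proof -
  show "bottom_position [(i, True), (Suc i, True), (i, True)] =
     bottom_position [(Suc i, True), (i, True), (Suc i, True)]"
    by (rule ext) (simp add: transpose_def)
  show "crossing_matrix_of_diagram [(i, True), (Suc i, True), (i, True)] =
     crossing_matrix_of_diagram [(Suc i, True), (i, True), (Suc i, True)]"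
    by (intro ext)
      (simp only: crossing_matrix_of_diagram_Cons letter_crossing_def transpose_eq_iff' if_True
        crossing_matrix_of_diagram_Nil, simp add: transpose_def)
qed

lemma crossings_far:
  assumes "i + 1 < j \<or> j + 1 < i"
  shows "bottom_position [(i, True), (j, True)] = bottom_position [(j, True), (i, True)]"
    "crossing_matrix_of_diagram [(i, True), (j, True)] = crossing_matrix_of_diagram [(j, True), (i, True)]"
proof -
  show "bottom_position [(i, True), (j, True)] = bottom_position [(j, True), (i, True)]"
    using assms by (intro ext) (auto simp: transpose_def)
  show "crossing_matrix_of_diagram [(i, True), (j, True)] = crossing_matrix_of_diagram [(j, True), (i, True)]"
    using assms by (intro ext)
      (simp only: crossing_matrix_of_diagram_Cons letter_crossing_def transpose_eq_iff' if_True
        crossing_matrix_of_diagram_Nil, auto simp: transpose_def)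
qed

lemma braid_relations_crossings:
  assumes "(l, r) \<in> braid_relations m"
  shows "bottom_position l = bottom_position r"
    and "crossing_matrix_of_diagram l = crossing_matrix_of_diagram r"
proof -
  consider i where "l = [(i, True), (Suc i, True), (i, True)]" "r = [(Suc i, True), (i, True), (Suc i, True)]"
    | i where "r = [(i, True), (Suc i, True), (i, True)]" "l = [(Suc i, True), (i, True), (Suc i, True)]"
    | i j where "l = [(i, True), (j, True)]" "r = [(j, True), (i, True)]" "i + 1 < j \<or> j + 1 < i"
    using assms unfolding braid_relations_def by fastforce
  then have "bottom_position l = bottom_position r \<and>
      crossing_matrix_of_diagram l = crossing_matrix_of_diagram r"
    by cases (metis crossings_braid, metis crossings_braid, metis crossings_far)
  then show "bottom_position l = bottom_position r"
    "crossing_matrix_of_diagram l = crossing_matrix_of_diagram r" by auto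
qed

text \<open>Equal matrices of the two sides of a relation would not suffice inside a longer word:
  whatever follows is reindexed by \<open>bottom_position\<close>, so the permutations must agree as
  well.\<close>

lemma pres_eq_crossings:
  assumes "pres_eq S (braid_relations m) v w"
  shows "crossing_matrix_of_diagram v = crossing_matrix_of_diagram w"
  using assms
proof (induction rule: pres_eq.induct)
  case (cancel u v g e)
  \<comment> \<open>Both crossings have the same over-string and under-string, as the first letter
    exchanges the positions, and opposite signs.\<close>
  have "crossing_matrix_of_diagram [(g, e), (g, \<not> e)] i j = 0" for i j
    by (auto simp: crossing_matrix_of_diagram_Cons letter_crossing_def transpose_def)
  moreover have "bottom_position [(g, e), (g, \<not> e)] i = i" for i
    by simp
  ultimately show ?case
    by (intro ext) (simp only: crossing_matrix_of_diagram_append add_0_left)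
next
  case (rel u v l r)
  then show ?case using braid_relations_crossings[of l r m]
    by (intro ext) (simp only: crossing_matrix_of_diagram_append)
qed auto

lemma crossing_matrix_pres_class:
  assumes "w \<in> words {1..<m}"
  shows "crossing_matrix (pres_class {1..<m} (braid_relations m) w) = crossing_matrix_of_diagram w"
  unfolding crossing_matrix_def
proof (rule the_equality)
  show "\<forall>v\<in>pres_class {1..<m} (braid_relations m) w. crossing_matrix_of_diagram w = crossing_matrix_of_diagram v"
    by (auto simp: pres_class_def dest: pres_eq_crossings)
  fix M assume "\<forall>v\<in>pres_class {1..<m} (braid_relations m) w. M = crossing_matrix_of_diagram v"
  then show "M = crossing_matrix_of_diagram w"
    using pres_class_self[OF assms] by blast
qed

lemma transpose_range:
  fixes k :: nat
  assumes "k \<in> {1..<m}"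
  shows "transpose k (k + 1) i \<in> {1..m} \<longleftrightarrow> i \<in> {1..m}"
  using assms by (auto simp: transpose_def)

text \<open>\<open>delta\<close> is specified on \<open>Mat0 m\<close> only. Transposing both
  indices preserves the range and the diagonal, so each letter keeps the matrix there.\<close>

lemma crossing_matrix_of_diagram_Mat0:
  assumes "w \<in> words {1..<m}"
  shows "crossing_matrix_of_diagram w \<in> Mat0 m"
  using assms
proof (induction w)
  case (Cons x w)
  obtain k e where x: "x = (k, e)" by fastforce
  have k: "k \<in> {1..<m}" and IH: "crossing_matrix_of_diagram w \<in> Mat0 m" using Cons x by auto
  have "letter_crossing k e \<in> Mat0 m"
    using k by (auto simp: letter_crossing_def Mat0_def split: if_splits)
  moreover have "letter_crossing k e i j \<noteq> 0 \<or>
      crossing_matrix_of_diagram w (transpose k (k + 1) i) (transpose k (k + 1) j) \<noteq> 0"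
    if "crossing_matrix_of_diagram (x # w) i j \<noteq> 0" for i j
    using that by (auto simp: x crossing_matrix_of_diagram_Cons)
  moreover have "crossing_matrix_of_diagram (x # w) i i = 0" for i
    using IH calculation(1) by (simp add: x crossing_matrix_of_diagram_Cons Mat0_def)
  ultimately show ?case
    using IH transpose_range[OF k] unfolding Mat0_def mem_Collect_eq by blast
qed (simp add: Mat0_def)

section \<open>The Artin representation\<close>

context free_group_rank
begin

definition free_lift :: "(nat \<Rightarrow> nat word set) \<Rightarrow> nat word set \<Rightarrow> nat word set" where
  "free_lift f = (SOME h. h \<in> hom F F \<and> h \<in> extensional (carrier F) \<and> (\<forall>i\<in>{1..m}. h (x_gen m i) = f i))"

lemma free_lift:
  assumes "\<And>i. i \<in> {1..m} \<Longrightarrow> f i \<in> carrier F"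
  shows "free_lift f \<in> hom F F" "free_lift f \<in> extensional (carrier F)"
    "\<And>i. i \<in> {1..m} \<Longrightarrow> free_lift f (x_gen m i) = f i"
proof -
  have "f \<in> {1..m} \<rightarrow> carrier F" using assms by blast
  from free_group_hom_exists[OF F.is_group this]
  have "\<exists>h. h \<in> hom F F \<and> h \<in> extensional (carrier F) \<and> (\<forall>i\<in>{1..m}. h (x_gen m i) = f i)"
    by metis
  from someI_ex[OF this] show "free_lift f \<in> hom F F" "free_lift f \<in> extensional (carrier F)"
    "\<And>i. i \<in> {1..m} \<Longrightarrow> free_lift f (x_gen m i) = f i"
    unfolding free_lift_def by blast+
qed

definition artin_image :: "nat \<Rightarrow> nat \<Rightarrow> nat word set" where
  "artin_image k j = (if j = k then x_gen m (k + 1)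
     else if j = k + 1 then inv\<^bsub>F\<^esub> x_gen m (k + 1) \<otimes>\<^bsub>F\<^esub> x_gen m k \<otimes>\<^bsub>F\<^esub> x_gen m (k + 1)
     else x_gen m j)"

text \<open>The images of the generators under the inverse of sigma_k, found by solving for the
  preimages of x_k and x_(k+1).\<close>

definition artin_inv_image :: "nat \<Rightarrow> nat \<Rightarrow> nat word set" where
  "artin_inv_image k j = (if j = k + 1 then x_gen m k
     else if j = k then x_gen m k \<otimes>\<^bsub>F\<^esub> x_gen m (k + 1) \<otimes>\<^bsub>F\<^esub> inv\<^bsub>F\<^esub> x_gen m k
     else x_gen m j)"

definition artin_gen :: "nat \<Rightarrow> nat word set \<Rightarrow> nat word set" where
  "artin_gen k = free_lift (artin_image k)"

lemma artin_image_closed: "k \<in> {1..<m} \<Longrightarrow> j \<in> {1..m} \<Longrightarrow> artin_image k j \<in> carrier F"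
  by (simp add: artin_image_def)

lemma artin_inv_image_closed: "k \<in> {1..<m} \<Longrightarrow> j \<in> {1..m} \<Longrightarrow> artin_inv_image k j \<in> carrier F"
  by (simp add: artin_inv_image_def)

lemma artin_gen_x_gen:
  "k \<in> {1..<m} \<Longrightarrow> j \<in> {1..m} \<Longrightarrow> artin_gen k (x_gen m j) = artin_image k j"
  unfolding artin_gen_def by (rule free_lift(3)) (simp_all only: artin_image_closed)

text \<open>Together with \<open>F.m_assoc\<close> these rules reduce right-nested products, which
  is how the identities between Artin automorphisms are checked on generators.\<close>

lemma F_cancel:
  "x \<in> carrier F \<Longrightarrow> y \<in> carrier F \<Longrightarrow> x \<otimes>\<^bsub>F\<^esub> (inv\<^bsub>F\<^esub> x \<otimes>\<^bsub>F\<^esub> y) = y"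
  "x \<in> carrier F \<Longrightarrow> y \<in> carrier F \<Longrightarrow> inv\<^bsub>F\<^esub> x \<otimes>\<^bsub>F\<^esub> (x \<otimes>\<^bsub>F\<^esub> y) = y"
  by (simp_all flip: F.m_assoc)

lemma hom_F_simps:
  assumes "h \<in> hom F F" "x \<in> carrier F"
  shows "h x \<in> carrier F" "h (inv\<^bsub>F\<^esub> x) = inv\<^bsub>F\<^esub> h x"
    "y \<in> carrier F \<Longrightarrow> h (x \<otimes>\<^bsub>F\<^esub> y) = h x \<otimes>\<^bsub>F\<^esub> h y"
  using group_hom.hom_inv[OF group_hom_F[OF F.is_group assms(1)] assms(2)] hom_mult[OF assms]
    hom_in_carrier[OF assms] by simp_all

lemma artin_gen_inverse:
  assumes k: "k \<in> {1..<m}" and x: "x \<in> carrier F"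
  shows "artin_gen k (free_lift (artin_inv_image k) x) = x" "free_lift (artin_inv_image k) (artin_gen k x) = x"
proof -
  let ?e = "artin_gen k" and ?e' = "free_lift (artin_inv_image k)"
  have e: "?e \<in> hom F F" unfolding artin_gen_def using artin_image_closed[OF k] by (rule free_lift)
  have e': "?e' \<in> hom F F" using artin_inv_image_closed[OF k] by (rule free_lift)
  have e'_gen: "?e' (x_gen m j) = artin_inv_image k j" if "j \<in> {1..m}" for j
    using artin_inv_image_closed[OF k] that by (rule free_lift(3))
  have id: "(\<lambda>x. x) \<in> hom F F" by (simp add: hom_def)
  have gens: "x_gen m k \<in> carrier F" "x_gen m (k + 1) \<in> carrier F" "k \<in> {1..m}" "k + 1 \<in> {1..m}"
    using k by simp_all
  have "(?e \<circ> ?e') x = x"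
  proof (rule free_group_hom_eq[OF F.is_group hom_compose[OF e' e] id _ x])
    fix i assume i: "i \<in> {1..m}"
    then have "?e (artin_inv_image k i) = x_gen m i"
      using gens artin_gen_x_gen[OF k] x_gen_closed[OF i]
      by (simp add: artin_inv_image_def artin_image_def hom_F_simps[OF e] F.m_assoc F_cancel)
    then show "(?e \<circ> ?e') (x_gen m i) = x_gen m i" using e'_gen[OF i] by simp
  qed
  then show "?e (?e' x) = x" by simp
  have "(?e' \<circ> ?e) x = x"
  proof (rule free_group_hom_eq[OF F.is_group hom_compose[OF e e'] id _ x])
    fix i assume i: "i \<in> {1..m}"
    then have "?e' (artin_image k i) = x_gen m i"
      using gens e'_gen x_gen_closed[OF i]
      by (simp add: artin_inv_image_def artin_image_def hom_F_simps[OF e'] F.m_assoc F_cancel)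
    then show "(?e' \<circ> ?e) (x_gen m i) = x_gen m i" using artin_gen_x_gen[OF k i] by simp
  qed
  then show "?e' (?e x) = x" by simp
qed

lemma artin_gen_auto:
  assumes k: "k \<in> {1..<m}"
  shows "artin_gen k \<in> auto F"
proof -
  have e: "artin_gen k \<in> hom F F" "artin_gen k \<in> extensional (carrier F)"
    unfolding artin_gen_def using artin_image_closed[OF k] by (blast intro: free_lift)+
  have e': "free_lift (artin_inv_image k) \<in> hom F F" using artin_inv_image_closed[OF k] by (rule free_lift)
  have "bij_betw (artin_gen k) (carrier F) (carrier F)"
    using artin_gen_inverse[OF k] hom_in_carrier[OF e(1)] hom_in_carrier[OF e']
    by (intro bij_betw_byWitness[where f' = "free_lift (artin_inv_image k)"]) auto
  then show ?thesis using e by (simp add: auto_def Bij_def)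
qed

lemma artin_gen_inv_x_gen:
  assumes k: "k \<in> {1..<m}" and j: "j \<in> {1..m}"
  shows "(inv\<^bsub>AutoGroup F\<^esub> artin_gen k) (x_gen m j) = artin_inv_image k j"
proof -
  let ?y = "free_lift (artin_inv_image k) (x_gen m j)"
  have y: "?y = artin_inv_image k j" using artin_inv_image_closed[OF k] j by (rule free_lift(3))
  have "(inv\<^bsub>AutoGroup F\<^esub> artin_gen k) (artin_gen k ?y) = ?y"
    using artin_inv_image_closed[OF k j] y artin_gen_auto[OF k] by (intro Aut_inv) simp_all
  then show ?thesis using artin_gen_inverse(1)[OF k x_gen_closed[OF j]] y by simp
qed

lemma auto_eqI:
  assumes "\<phi> \<in> auto F" "\<psi> \<in> auto F" "\<And>i. i \<in> {1..m} \<Longrightarrow> \<phi> (x_gen m i) = \<psi> (x_gen m i)"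
  shows "\<phi> = \<psi>"
proof (rule extensionalityI)
  show "\<phi> \<in> extensional (carrier F)" "\<psi> \<in> extensional (carrier F)"
    using assms by (simp_all add: auto_def Bij_def)
  show "\<phi> x = \<psi> x" if "x \<in> carrier F" for x
    using free_group_hom_eq[OF F.is_group auto_hom[OF assms(1)] auto_hom[OF assms(2)] assms(3) that] .
qed

text \<open>Automorphisms are determined by the generators; there both sides are expanded to words
  in x_i, x_(i+1), x_(i+2) and freely reduced.\<close>

lemma artin_gen_braid:
  assumes "i \<in> {1..<m}" "Suc i \<in> {1..<m}"
  shows "artin_gen i \<otimes>\<^bsub>AutoGroup F\<^esub> (artin_gen (Suc i) \<otimes>\<^bsub>AutoGroup F\<^esub> artin_gen i) =
    artin_gen (Suc i) \<otimes>\<^bsub>AutoGroup F\<^esub> (artin_gen i \<otimes>\<^bsub>AutoGroup F\<^esub> artin_gen (Suc i))"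
proof -
  note a = artin_gen_auto[OF assms(1)] artin_gen_auto[OF assms(2)]
  note h = auto_hom[OF a(1)] auto_hom[OF a(2)]
  note g = artin_gen_x_gen[OF assms(1)] artin_gen_x_gen[OF assms(2)]
  have clo: "\<phi> \<otimes>\<^bsub>AutoGroup F\<^esub> \<psi> \<in> auto F" if "\<phi> \<in> auto F" "\<psi> \<in> auto F" for \<phi> \<psi>
    using Aut.m_closed that by simp
  have gens: "x_gen m i \<in> carrier F" "x_gen m (Suc i) \<in> carrier F" "x_gen m (Suc (Suc i)) \<in> carrier F"
    "i \<in> {1..m}" "Suc i \<in> {1..m}" "Suc (Suc i) \<in> {1..m}"
    using assms by simp_all
  show ?thesis
  proof (rule auto_eqI)
    fix j assume j: "j \<in> {1..m}"
    show "(artin_gen i \<otimes>\<^bsub>AutoGroup F\<^esub> (artin_gen (Suc i) \<otimes>\<^bsub>AutoGroup F\<^esub> artin_gen i)) (x_gen m j) =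
      (artin_gen (Suc i) \<otimes>\<^bsub>AutoGroup F\<^esub> (artin_gen i \<otimes>\<^bsub>AutoGroup F\<^esub> artin_gen (Suc i))) (x_gen m j)"
      using gens j a x_gen_closed[OF j]
      by (simp add: Aut_mult clo g artin_image_def hom_F_simps[OF h(1)] hom_F_simps[OF h(2)]
          F.m_assoc F_cancel F.inv_mult_group)
  qed (simp_all add: a clo)
qed

lemma artin_gen_commute:
  assumes "i \<in> {1..<m}" "j \<in> {1..<m}" "i + 1 < j \<or> j + 1 < i"
  shows "artin_gen i \<otimes>\<^bsub>AutoGroup F\<^esub> artin_gen j = artin_gen j \<otimes>\<^bsub>AutoGroup F\<^esub> artin_gen i"
proof -
  note a = artin_gen_auto[OF assms(1)] artin_gen_auto[OF assms(2)]
  note h = auto_hom[OF a(1)] auto_hom[OF a(2)]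
  note g = artin_gen_x_gen[OF assms(1)] artin_gen_x_gen[OF assms(2)]
  have gens: "x_gen m i \<in> carrier F" "x_gen m (i + 1) \<in> carrier F" "x_gen m j \<in> carrier F"
    "x_gen m (j + 1) \<in> carrier F" "i \<in> {1..m}" "i + 1 \<in> {1..m}" "j \<in> {1..m}" "j + 1 \<in> {1..m}"
    using assms by simp_all
  show ?thesis
  proof (rule auto_eqI)
    fix p assume p: "p \<in> {1..m}"
    show "(artin_gen i \<otimes>\<^bsub>AutoGroup F\<^esub> artin_gen j) (x_gen m p) = (artin_gen j \<otimes>\<^bsub>AutoGroup F\<^esub> artin_gen i) (x_gen m p)"
      using gens p a x_gen_closed[OF p] assms(3)
      by (auto simp: Aut_mult g artin_image_def hom_F_simps[OF h(1)] hom_F_simps[OF h(2)])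
  qed (use Aut.m_closed a in simp_all)
qed

definition is_artin_rep :: "(nat word set \<Rightarrow> nat word set \<Rightarrow> nat word set) \<Rightarrow> bool" where
  "is_artin_rep \<rho> \<longleftrightarrow> \<rho> \<in> hom (braid_group m) (AutoGroup F) \<and> \<rho> \<in> extensional (carrier (braid_group m)) \<and>
     (\<forall>i\<in>{1..<m}.
        \<rho> (sigma m i) (x_gen m i) = x_gen m (i + 1) \<and>
        \<rho> (sigma m i) (x_gen m (i + 1)) = inv\<^bsub>F\<^esub> x_gen m (i + 1) \<otimes>\<^bsub>F\<^esub> x_gen m i \<otimes>\<^bsub>F\<^esub> x_gen m (i + 1) \<and>
        (\<forall>k\<in>{1..m} - {i, i + 1}. \<rho> (sigma m i) (x_gen m k) = x_gen m k))"

lemma sigma_closed: "i \<in> {1..<m} \<Longrightarrow> sigma m i \<in> carrier (braid_group m)"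
  by (auto simp: sigma_def braid_group_def)

lemma is_artin_rep_sigma:
  assumes "is_artin_rep \<rho>" "k \<in> {1..<m}"
  shows "\<rho> (sigma m k) = artin_gen k"
proof (rule auto_eqI[OF _ artin_gen_auto[OF assms(2)]])
  show "\<rho> (sigma m k) \<in> auto F"
    using assms hom_in_carrier[of \<rho> _ "AutoGroup F", OF _ sigma_closed[OF assms(2)]]
    by (simp add: is_artin_rep_def)
  show "\<rho> (sigma m k) (x_gen m i) = artin_gen k (x_gen m i)" if "i \<in> {1..m}" for i
    using assms that by (auto simp: is_artin_rep_def artin_gen_x_gen[OF assms(2) that] artin_image_def)
qed

text \<open>Existence is von Dyck's theorem, given the braid relations between the
  \<open>artin_gen\<close>. Uniqueness holds because every candidate sends \<open>sigma m k\<close>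
  to \<open>artin_gen k\<close>.\<close>

lemma is_artin_rep_artin_rep: "is_artin_rep (artin_rep m)"
proof -
  have rel: "word_eval (AutoGroup F) artin_gen l = word_eval (AutoGroup F) artin_gen r"
    if lr: "(l, r) \<in> braid_relations m" for l r
  proof -
    have eval2: "word_eval (AutoGroup F) artin_gen [(i, True), (j, True)] =
        artin_gen i \<otimes>\<^bsub>AutoGroup F\<^esub> artin_gen j" if "j \<in> {1..<m}" for i j
      using artin_gen_auto[OF that] by simp
    have eval3: "word_eval (AutoGroup F) artin_gen [(i, True), (j, True), (i, True)] =
        artin_gen i \<otimes>\<^bsub>AutoGroup F\<^esub> (artin_gen j \<otimes>\<^bsub>AutoGroup F\<^esub> artin_gen i)" if "i \<in> {1..<m}" for i j
      using artin_gen_auto[OF that] by simp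
    \<comment> \<open>\<open>braid_relations\<close> contains each cubic relation in both
      directions, hence the mirrored second case.\<close>
    consider i where "i \<in> {1..<m}" "i + 1 \<in> {1..<m}"
        "l = [(i, True), (i + 1, True), (i, True)]" "r = [(i + 1, True), (i, True), (i + 1, True)]"
      | i where "i \<in> {1..<m}" "i + 1 \<in> {1..<m}"
        "r = [(i, True), (i + 1, True), (i, True)]" "l = [(i + 1, True), (i, True), (i + 1, True)]"
      | i j where "l = [(i, True), (j, True)]" "r = [(j, True), (i, True)]"
        "i \<in> {1..<m}" "j \<in> {1..<m}" "i + 1 < j \<or> j + 1 < i"
      using lr unfolding braid_relations_def by blast
    then show ?thesis
    proof cases
      case 1
      then show ?thesis
        using artin_gen_braid[of i] eval3[of i "i + 1"] eval3[of "i + 1" i] by simp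
    next
      case 2
      then show ?thesis
        using artin_gen_braid[of i] eval3[of i "i + 1"] eval3[of "i + 1" i] by simp
    next
      case 3
      show ?thesis
        unfolding 3(1,2) eval2[OF 3(3)] eval2[OF 3(4)] by (rule artin_gen_commute[OF 3(3-5)])
    qed
  qed
  obtain \<rho> where \<rho>: "\<rho> \<in> hom (braid_group m) (AutoGroup F)" "\<rho> \<in> extensional (carrier (braid_group m))"
    "\<And>w. w \<in> words {1..<m} \<Longrightarrow>
      \<rho> (pres_class {1..<m} (braid_relations m) w) = word_eval (AutoGroup F) artin_gen w"
    using Aut.presented_group_hom_exists[of artin_gen "{1..<m}" "braid_relations m"] artin_gen_auto rel
    unfolding braid_group_def by auto
  have "\<rho> (sigma m i) = artin_gen i" if "i \<in> {1..<m}" for i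
    using \<rho>(3)[of "[(i, True)]"] that artin_gen_auto[OF that] by (simp add: sigma_def)
  then have "is_artin_rep \<rho>"
    using \<rho>(1,2) artin_gen_x_gen by (simp add: is_artin_rep_def artin_image_def)
  moreover have "\<rho>' = \<rho>" if "is_artin_rep \<rho>'" for \<rho>'
  proof (rule extensionalityI)
    show "\<rho>' \<in> extensional (carrier (braid_group m))" using that by (simp add: is_artin_rep_def)
    show "\<rho>' x = \<rho> x" if x: "x \<in> carrier (braid_group m)" for x
    proof (rule Aut.presented_group_hom_eq)
      show "\<rho>' \<in> hom (presented_group {1..<m} (braid_relations m)) (AutoGroup F)"
        "\<rho> \<in> hom (presented_group {1..<m} (braid_relations m)) (AutoGroup F)"
        using \<open>is_artin_rep \<rho>'\<close> \<rho>(1) unfolding is_artin_rep_def braid_group_def by blast+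
      show "x \<in> carrier (presented_group {1..<m} (braid_relations m))"
        using x unfolding braid_group_def .
      fix g assume g: "g \<in> {1..<m}"
      have "\<rho>' (sigma m g) = \<rho> (sigma m g)"
        using is_artin_rep_sigma[OF \<open>is_artin_rep \<rho>'\<close> g] is_artin_rep_sigma[OF \<open>is_artin_rep \<rho>\<close> g] by simp
      then show "\<rho>' (pres_class {1..<m} (braid_relations m) [(g, True)]) =
          \<rho> (pres_class {1..<m} (braid_relations m) [(g, True)])"
        unfolding sigma_def .
    qed
  qed (fact \<rho>(2))
  ultimately have "is_artin_rep (THE \<rho>. is_artin_rep \<rho>)" by (rule theI)
  then show ?thesis by (simp add: artin_rep_def is_artin_rep_def[abs_def])
qed

end

section \<open>The Johnson homomorphism of a braid\<close>

context comm_group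
begin

lemma wedge_closed [simp]:
  assumes "a \<in> carrier G" "b \<in> carrier G"
  shows "wedge G a b \<in> carrier (tensor_power G 2)"
proof -
  interpret T2: comm_group "tensor_power G 2" by (rule comm_group_tensor_power)
  show ?thesis using assms by (simp add: wedge_def)
qed

lemma wedge_mult_right:
  assumes "a \<in> carrier G" "b \<in> carrier G" "c \<in> carrier G"
  shows "wedge G a (b \<otimes> c) = wedge G a b \<otimes>\<^bsub>tensor_power G 2\<^esub> wedge G a c"
proof -
  interpret T2: comm_group "tensor_power G 2" by (rule comm_group_tensor_power)
  show ?thesis using assms by (simp add: wedge_def pure_tensor2_mult T2.inv_mult T2.m_ac)
qed

lemma wedge_one_right:
  assumes "a \<in> carrier G"
  shows "wedge G a \<one> = \<one>\<^bsub>tensor_power G 2\<^esub>"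
proof -
  interpret T2: comm_group "tensor_power G 2" by (rule comm_group_tensor_power)
  \<comment> \<open>An idempotent of a group is trivial.\<close>
  have "wedge G a \<one> \<otimes>\<^bsub>tensor_power G 2\<^esub> wedge G a \<one> = wedge G a \<one>"
    using assms wedge_mult_right[of a \<one> \<one>] by simp
  then show ?thesis using assms T2.l_cancel_one'[of "wedge G a \<one>" "wedge G a \<one>"] by simp
qed

lemma wedge_inv_right:
  assumes "a \<in> carrier G" "b \<in> carrier G"
  shows "wedge G a (inv b) = inv\<^bsub>tensor_power G 2\<^esub> wedge G a b"
proof -
  interpret T2: comm_group "tensor_power G 2" by (rule comm_group_tensor_power)
  have "wedge G a (inv b) \<otimes>\<^bsub>tensor_power G 2\<^esub> wedge G a b = \<one>\<^bsub>tensor_power G 2\<^esub>"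
    using assms wedge_mult_right[of a "inv b" b] by (simp add: wedge_one_right)
  then show ?thesis using assms T2.inv_equality[of "wedge G a (inv b)" "wedge G a b"] by simp
qed

lemma tensor_map_wedge:
  assumes f: "f \<in> hom G G" and "a \<in> carrier G" "b \<in> carrier G"
  shows "tensor_map G f 2 (wedge G a b) = wedge G (f a) (f b)"
proof -
  interpret T2: comm_group "tensor_power G 2" by (rule comm_group_tensor_power)
  interpret f: group_hom "tensor_power G 2" "tensor_power G 2" "tensor_map G f 2"
    using tensor_map_hom[OF f] by (simp add: group_hom_def group_hom_axioms_def)
  show ?thesis using assms by (simp add: wedge_def tensor_map_pure)
qed

end

section \<open>The elements \<open>f_vec\<close> and their transposition\<close>

context free_group_rank
begin

lemma f_vec_closed [simp]: "f_vec m i M \<in> carrier H"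
  unfolding f_vec_def by (rule H.finprod_closed) simp

lemma f_vec_add: "f_vec m i (\<lambda>k l. M k l + N k l) = f_vec m i M \<otimes>\<^bsub>H\<^esub> f_vec m i N"
proof -
  have "f_vec m i (\<lambda>k l. M k l + N k l) =
      (\<Otimes>\<^bsub>H\<^esub>k\<in>{1..m}. X_gen m k [^]\<^bsub>H\<^esub> M k i \<otimes>\<^bsub>H\<^esub> X_gen m k [^]\<^bsub>H\<^esub> N k i)"
    unfolding f_vec_def by (intro H.finprod_cong' refl) (auto simp: H.int_pow_mult)
  also have "\<dots> = f_vec m i M \<otimes>\<^bsub>H\<^esub> f_vec m i N"
    unfolding f_vec_def by (intro H.finprod_multf) auto
  finally show ?thesis .
qed

lemma f_vec_zero: "(\<And>k. M k i = 0) \<Longrightarrow> f_vec m i M = \<one>\<^bsub>H\<^esub>"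
  by (simp add: f_vec_def)

lemma f_vec_single:
  assumes "k \<in> {1..m}" "\<And>l. l \<noteq> k \<Longrightarrow> M l i = 0"
  shows "f_vec m i M = X_gen m k [^]\<^bsub>H\<^esub> M k i"
proof -
  have "f_vec m i M = (\<Otimes>\<^bsub>H\<^esub>l\<in>{1..m}. if k = l then X_gen m l [^]\<^bsub>H\<^esub> M l i else \<one>\<^bsub>H\<^esub>)"
    unfolding f_vec_def using assms by (intro H.finprod_cong' refl) auto
  also have "\<dots> = X_gen m k [^]\<^bsub>H\<^esub> M k i"
    using assms(1) by (intro H.finprod_singleton) auto
  finally show ?thesis .
qed

text \<open>The matrix rule for a letter in front, seen in \<open>H\<close>: the column index is
  transposed from the start, and reindexing the product over {1..m} moves the transposition from the
  basis elements to the row index.\<close>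

lemma hom_f_vec:
  assumes k: "k \<in> {1..<m}" and f: "f \<in> hom H H"
    and fX: "\<And>p. p \<in> {1..m} \<Longrightarrow> f (X_gen m p) = X_gen m (transpose k (k + 1) p)"
  shows "f (f_vec m (transpose k (k + 1) i) M) =
    f_vec m i (\<lambda>a b. M (transpose k (k + 1) a) (transpose k (k + 1) b))"
proof -
  let ?t = "transpose k (k + 1)"
  interpret f: group_hom H H f using f by (simp add: group_hom_def group_hom_axioms_def)
  have fprod: "f (\<Otimes>\<^bsub>H\<^esub>p\<in>A. g p) = (\<Otimes>\<^bsub>H\<^esub>p\<in>A. f (g p))"
    if "finite A" "g \<in> A \<rightarrow> carrier H" for A and g :: "nat \<Rightarrow> nat word set set"
    using that by (induction A rule: finite_induct) (auto simp: Pi_iff)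
  have inj: "inj_on ?t {1..m}" by (rule inj_on_inverseI[where g = ?t]) simp
  have img: "?t ` {1..m} = {1..m}"
  proof
    show "?t ` {1..m} \<subseteq> {1..m}" using transpose_range[OF k] by blast
    show "{1..m} \<subseteq> ?t ` {1..m}"
      using transpose_range[OF k] by (metis imageI subsetI transpose_involutory)
  qed
  have clo: "X_gen m p [^]\<^bsub>H\<^esub> M p (?t i) \<in> carrier H" if "p \<in> {1..m}" for p
    using that by simp
  have "f (f_vec m (?t i) M) = (\<Otimes>\<^bsub>H\<^esub>p\<in>{1..m}. f (X_gen m p [^]\<^bsub>H\<^esub> M p (?t i)))"
    unfolding f_vec_def using clo by (intro fprod) auto
  \<comment> \<open>The row p is written as the double transpose of p, which makes every factor a
    function of the transposed index alone.\<close>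
  also have "\<dots> = (\<Otimes>\<^bsub>H\<^esub>p\<in>{1..m}. X_gen m (?t p) [^]\<^bsub>H\<^esub> M (?t (?t p)) (?t i))"
    using fX transpose_range[OF k] by (intro H.finprod_cong' refl) (auto simp: f.hom_int_pow)
  also have "\<dots> = (\<Otimes>\<^bsub>H\<^esub>p\<in>?t ` {1..m}. X_gen m p [^]\<^bsub>H\<^esub> M (?t p) (?t i))"
    using transpose_range[OF k] inj
    by (intro H.finprod_reindex[symmetric]) (auto simp only: img intro!: X_gen_closed)
  finally show ?thesis unfolding img f_vec_def .
qed

section \<open>The Johnson homomorphism on the letters\<close>

lemma ab_class_conj:
  assumes "x \<in> carrier F" "z \<in> carrier F"
  shows "ab_class m (inv\<^bsub>F\<^esub> z \<otimes>\<^bsub>F\<^esub> x \<otimes>\<^bsub>F\<^esub> z) = ab_class m x"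
proof -
  have "inv\<^bsub>H\<^esub> b \<otimes>\<^bsub>H\<^esub> a \<otimes>\<^bsub>H\<^esub> b = a" if "a \<in> carrier H" "b \<in> carrier H" for a b
    using that by (simp add: H.m_comm[of "inv\<^bsub>H\<^esub> b"] H.m_assoc)
  then show ?thesis using assms by simp
qed

text \<open>For y = z\<inverse> x z, expanding \<theta>_2 on both sides of z y = x z and cancelling
  \<theta>_2(z) isolates \<theta>_2(y); the value of \<theta>_2 at z\<inverse> never has to be
  computed.\<close>

lemma magnus_2_conj:
  assumes x: "x \<in> carrier F" and z: "z \<in> carrier F"
  shows "magnus m (inv\<^bsub>F\<^esub> z \<otimes>\<^bsub>F\<^esub> x \<otimes>\<^bsub>F\<^esub> z) 2 =
    wedge H (ab_class m x) (ab_class m z) \<otimes>\<^bsub>T2\<^esub> magnus m x 2"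
proof -
  let ?y = "inv\<^bsub>F\<^esub> z \<otimes>\<^bsub>F\<^esub> x \<otimes>\<^bsub>F\<^esub> z"
  have y: "?y \<in> carrier F" using x z by simp
  have "z \<otimes>\<^bsub>F\<^esub> ?y = x \<otimes>\<^bsub>F\<^esub> z" using x z by (simp add: F.m_assoc F_cancel)
  then have "magnus m (z \<otimes>\<^bsub>F\<^esub> ?y) 2 = magnus m (x \<otimes>\<^bsub>F\<^esub> z) 2" by simp
  then have eq: "magnus m z 2 \<otimes>\<^bsub>T2\<^esub> pure_tensor H [ab_class m z, ab_class m x] \<otimes>\<^bsub>T2\<^esub> magnus m ?y 2 =
      magnus m x 2 \<otimes>\<^bsub>T2\<^esub> pure_tensor H [ab_class m x, ab_class m z] \<otimes>\<^bsub>T2\<^esub> magnus m z 2"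
    unfolding magnus_2_mult[OF z y] magnus_2_mult[OF x z] ab_class_conj[OF x z] .
  have solve: "c = b' \<otimes>\<^bsub>T2\<^esub> inv\<^bsub>T2\<^esub> b \<otimes>\<^bsub>T2\<^esub> a'"
    if "a \<otimes>\<^bsub>T2\<^esub> b \<otimes>\<^bsub>T2\<^esub> c = a' \<otimes>\<^bsub>T2\<^esub> b' \<otimes>\<^bsub>T2\<^esub> a" "a \<in> carrier T2" "b \<in> carrier T2" "c \<in> carrier T2"
      "a' \<in> carrier T2" "b' \<in> carrier T2" for a b c a' b'
  proof -
    have "a \<otimes>\<^bsub>T2\<^esub> (b \<otimes>\<^bsub>T2\<^esub> c) = a \<otimes>\<^bsub>T2\<^esub> (a' \<otimes>\<^bsub>T2\<^esub> b')"
      using that by (simp add: T2.m_ac)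
    then have "b \<otimes>\<^bsub>T2\<^esub> c = a' \<otimes>\<^bsub>T2\<^esub> b'" using that by (simp only: T2.l_cancel T2.m_closed)
    then have "c = inv\<^bsub>T2\<^esub> b \<otimes>\<^bsub>T2\<^esub> (a' \<otimes>\<^bsub>T2\<^esub> b')"
      using that T2.inv_solve_left[of c b "a' \<otimes>\<^bsub>T2\<^esub> b'"] by simp
    then show ?thesis using that by (simp add: T2.m_ac)
  qed
  show ?thesis
    unfolding wedge_def using x z y by (intro solve[OF eq]) simp_all
qed

definition artin_letter :: "nat \<Rightarrow> bool \<Rightarrow> nat word set \<Rightarrow> nat word set" where
  "artin_letter k e = (if e then artin_gen k else inv\<^bsub>AutoGroup F\<^esub> artin_gen k)"

lemma artin_letter_auto: "k \<in> {1..<m} \<Longrightarrow> artin_letter k e \<in> auto F"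
  by (simp add: artin_letter_def artin_gen_auto)

lemma artin_letter_x_gen:
  assumes "k \<in> {1..<m}" "p \<in> {1..m}"
  shows "artin_letter k e (x_gen m p) = (if e then artin_image k p else artin_inv_image k p)"
    "(inv\<^bsub>AutoGroup F\<^esub> artin_letter k e) (x_gen m p) = (if e then artin_inv_image k p else artin_image k p)"
  using assms artin_gen_auto[OF assms(1)] Aut.inv_inv[of "artin_gen k"]
  by (simp_all add: artin_letter_def artin_gen_x_gen artin_gen_inv_x_gen)

text \<open>Puts the image into the form z\<inverse> x z expected by \<open>johnson_conj\<close>,
  with z the inverse of x_k.\<close>

lemma artin_inv_image_conj:
  "k \<in> {1..<m} \<Longrightarrow> artin_inv_image k k =
    inv\<^bsub>F\<^esub> (inv\<^bsub>F\<^esub> x_gen m k) \<otimes>\<^bsub>F\<^esub> x_gen m (k + 1) \<otimes>\<^bsub>F\<^esub> inv\<^bsub>F\<^esub> x_gen m k"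
  by (simp add: artin_inv_image_def)

lemma ab_class_artin_image:
  assumes k: "k \<in> {1..<m}" and p: "p \<in> {1..m}"
  shows "ab_class m (artin_image k p) = X_gen m (transpose k (k + 1) p)"
    "ab_class m (artin_inv_image k p) = X_gen m (transpose k (k + 1) p)"
proof -
  have g: "x_gen m k \<in> carrier F" "x_gen m (k + 1) \<in> carrier F" using k by simp_all
  show "ab_class m (artin_image k p) = X_gen m (transpose k (k + 1) p)"
    using ab_class_conj[OF g] by (simp add: artin_image_def X_gen_def transpose_def del: ab_class_mult)
  show "ab_class m (artin_inv_image k p) = X_gen m (transpose k (k + 1) p)"
    using ab_class_conj[OF g(2) F.inv_closed[OF g(1)]] artin_inv_image_conj[OF k]
    by (auto simp: artin_inv_image_def X_gen_def transpose_def simp del: ab_class_mult)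
qed

lemma ab_map_artin_letter:
  assumes "k \<in> {1..<m}" "p \<in> {1..m}"
  shows "ab_map m (artin_letter k e) (X_gen m p) = X_gen m (transpose k (k + 1) p)"
  using assms ab_class_artin_image[OF assms]
  by (simp add: X_gen_def ab_map_ab_class auto_hom artin_letter_auto artin_letter_x_gen)

text \<open>\<theta>_2 vanishes on x_p and, by \<open>magnus_2_conj\<close>, equals the wedge of X_q
  and [z] on its preimage. The minus sign of \<tau> is moved into the second slot of the
  wedge.\<close>

lemma johnson_conj:
  assumes \<phi>: "\<phi> \<in> auto F" and p: "p \<in> {1..m}" and q: "q \<in> {1..m}" and z: "z \<in> carrier F"
    and "(inv\<^bsub>AutoGroup F\<^esub> \<phi>) (x_gen m p) = inv\<^bsub>F\<^esub> z \<otimes>\<^bsub>F\<^esub> x_gen m q \<otimes>\<^bsub>F\<^esub> z"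
  shows "johnson m \<phi> (X_gen m p) =
    wedge H (ab_map m \<phi> (X_gen m q)) (inv\<^bsub>H\<^esub> ab_map m \<phi> (ab_class m z))"
proof -
  note f = ab_map_hom[OF auto_hom[OF \<phi>]]
  have c: "ab_map m \<phi> (X_gen m q) \<in> carrier H" "ab_map m \<phi> (ab_class m z) \<in> carrier H"
    using hom_in_carrier[OF f] q z by simp_all
  have "johnson m \<phi> (X_gen m p) = inv\<^bsub>T2\<^esub> tensor_map H (ab_map m \<phi>) 2 (wedge H (X_gen m q) (ab_class m z))"
    using assms f X_gen_closed[OF q]
    by (simp add: X_gen_def johnson_ab_class johnson_lift_def magnus_2_conj magnus_gen)
  also have "\<dots> = wedge H (ab_map m \<phi> (X_gen m q)) (inv\<^bsub>H\<^esub> ab_map m \<phi> (ab_class m z))"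
    using q z c by (simp add: H.tensor_map_wedge[OF f] H.wedge_inv_right)
  finally show ?thesis .
qed

text \<open>Here \<theta>_2 vanishes on both generators involved, whether or not p and q are
  equal.\<close>

lemma johnson_gen_fixed:
  assumes \<phi>: "\<phi> \<in> auto F" and p: "p \<in> {1..m}" and q: "q \<in> {1..m}"
    and "(inv\<^bsub>AutoGroup F\<^esub> \<phi>) (x_gen m p) = x_gen m q"
  shows "johnson m \<phi> (X_gen m p) = \<one>\<^bsub>T2\<^esub>"
proof -
  note f = ab_map_hom[OF auto_hom[OF \<phi>]]
  have "group_hom T2 T2 (tensor_map H (ab_map m \<phi>) 2)"
    using H.tensor_map_hom[OF f] by (simp add: group_hom_def group_hom_axioms_def)
  from group_hom.hom_one[OF this] show ?thesis
    using assms by (simp add: X_gen_def johnson_ab_class johnson_lift_def magnus_gen)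
qed

text \<open>A letter has a single crossing, whose under-string is k for sigma_k and k + 1 for its
  inverse. Exactly at this p does the inverse of the letter send x_p to a conjugate that is not
  listed as a plain generator.\<close>

lemma johnson_artin_letter:
  assumes k: "k \<in> {1..<m}" and p: "p \<in> {1..m}"
  shows "johnson m (artin_letter k e) (X_gen m p) =
    wedge H (X_gen m p) (f_vec m p (letter_crossing k e))"
proof -
  have k': "k \<in> {1..m}" "k + 1 \<in> {1..m}" using k by simp_all
  then have g: "x_gen m k \<in> carrier F" "x_gen m (k + 1) \<in> carrier F"
    and X: "X_gen m k \<in> carrier H" "X_gen m (k + 1) \<in> carrier H"
    by (simp_all only: x_gen_closed X_gen_closed)
  note \<phi> = artin_letter_auto[OF k, of e]
  note f = ab_map_hom[OF auto_hom[OF \<phi>]]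
  interpret f: group_hom H H "ab_map m (artin_letter k e)"
    using f by (simp add: group_hom_def group_hom_axioms_def)
  have fX: "ab_map m (artin_letter k e) (X_gen m k) = X_gen m (k + 1)"
    "ab_map m (artin_letter k e) (X_gen m (k + 1)) = X_gen m k"
    using ab_map_artin_letter[OF k k'(1), of e] ab_map_artin_letter[OF k k'(2), of e] by simp_all
  consider "e" "p = k" | "\<not> e" "p = k + 1" | "p \<noteq> (if e then k else k + 1)" by (cases e) auto
  then show ?thesis
  proof cases
    case 1
    \<comment> \<open>Here z is the inverse of x_k: its sign and the one from
      \<open>johnson_conj\<close> cancel, which gives the positive crossing.\<close>
    have "johnson m (artin_letter k e) (X_gen m k) =
        wedge H (ab_map m (artin_letter k e) (X_gen m (k + 1)))
          (inv\<^bsub>H\<^esub> ab_map m (artin_letter k e) (ab_class m (inv\<^bsub>F\<^esub> x_gen m k)))"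
      using artin_letter_x_gen(2)[OF k k'(1), of e] artin_inv_image_conj[OF k] 1
      by (intro johnson_conj[OF \<phi> k'] F.inv_closed g) simp
    also have "\<dots> = wedge H (X_gen m k) (X_gen m (k + 1))"
      using fX X g by (simp flip: X_gen_def)
    also have "X_gen m (k + 1) = f_vec m k (letter_crossing k e)"
      using f_vec_single[OF k'(2), of "letter_crossing k e" k] 1 X by (simp add: letter_crossing_def)
    finally show ?thesis using 1 by simp
  next
    case 2
    \<comment> \<open>Here z is x_(k+1) itself, so the sign from \<open>johnson_conj\<close> remains
      and gives the negative crossing.\<close>
    have "johnson m (artin_letter k e) (X_gen m (k + 1)) =
        wedge H (ab_map m (artin_letter k e) (X_gen m k))
          (inv\<^bsub>H\<^esub> ab_map m (artin_letter k e) (ab_class m (x_gen m (k + 1))))"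
      using artin_letter_x_gen(2)[OF k k'(2), of e] 2
      by (intro johnson_conj[OF \<phi> k'(2,1)] g) (simp add: artin_image_def)
    also have "\<dots> = wedge H (X_gen m (k + 1)) (inv\<^bsub>H\<^esub> X_gen m k)"
      using fX by (simp flip: X_gen_def)
    also have "inv\<^bsub>H\<^esub> X_gen m k = f_vec m (k + 1) (letter_crossing k e)"
      using f_vec_single[OF k'(1), of "letter_crossing k e" "k + 1"] 2 X
      by (simp add: letter_crossing_def H.int_pow_neg)
    finally show ?thesis using 2 by simp
  next
    case 3
    have t: "transpose k (k + 1) p \<in> {1..m}" using p transpose_range[OF k] by simp
    have "(inv\<^bsub>AutoGroup F\<^esub> artin_letter k e) (x_gen m p) = x_gen m (transpose k (k + 1) p)"
      using 3 artin_letter_x_gen(2)[OF k p, of e]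
      by (cases e) (auto simp: artin_image_def artin_inv_image_def transpose_def split: if_splits)
    from johnson_gen_fixed[OF \<phi> p t this]
    have "johnson m (artin_letter k e) (X_gen m p) = \<one>\<^bsub>T2\<^esub>" .
    \<comment> \<open>Column p of the letter's matrix is zero, because p is not the
      under-string.\<close>
    moreover have "f_vec m p (letter_crossing k e) = \<one>\<^bsub>H\<^esub>"
      using 3 by (intro f_vec_zero, cases e) (auto simp: letter_crossing_def)
    ultimately show ?thesis using p by (simp add: H.wedge_one_right)
  qed
qed

section \<open>From letters to words\<close>

lemma artin_rep_Nil: "artin_rep m (pres_class {1..<m} (braid_relations m) []) = \<one>\<^bsub>AutoGroup F\<^esub>"
proof -
  have "group_hom (braid_group m) (AutoGroup F) (artin_rep m)"
    using is_artin_rep_artin_rep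
    by (simp add: group_hom_def group_hom_axioms_def is_artin_rep_def braid_group_def group_presented_group)
  from group_hom.hom_one[OF this] show ?thesis by (simp add: braid_group_def one_presented_group)
qed

lemma artin_rep_Cons:
  assumes k: "k \<in> {1..<m}" and w: "w \<in> words {1..<m}"
  shows "artin_rep m (pres_class {1..<m} (braid_relations m) ((k, e) # w)) =
    artin_letter k e \<otimes>\<^bsub>AutoGroup F\<^esub> artin_rep m (pres_class {1..<m} (braid_relations m) w)"
proof -
  let ?c = "pres_class {1..<m} (braid_relations m)"
  interpret \<rho>: group_hom "braid_group m" "AutoGroup F" "artin_rep m"
    using is_artin_rep_artin_rep
    by (simp add: group_hom_def group_hom_axioms_def is_artin_rep_def braid_group_def group_presented_group)
  have gen: "artin_rep m (sigma m k) = artin_gen k"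
    by (rule is_artin_rep_sigma[OF is_artin_rep_artin_rep k])
  have "?c [(k, False)] = inv\<^bsub>braid_group m\<^esub> sigma m k"
    using inv_pres_class_gen[OF k] by (simp add: braid_group_def sigma_def)
  then have "artin_rep m (?c [(k, e)]) = artin_letter k e"
    using gen sigma_closed[OF k] sigma_def[of m k]
    by (cases e) (simp_all add: artin_letter_def del: One_nat_def)
  moreover have "?c ((k, e) # w) = ?c [(k, e)] \<otimes>\<^bsub>braid_group m\<^esub> ?c w"
    using k w pres_class_mult[of "[(k, e)]" "{1..<m}" w "braid_relations m"]
    by (simp add: braid_group_def)
  moreover have "?c [(k, e)] \<in> carrier (braid_group m)" "?c w \<in> carrier (braid_group m)"
    using k w by (auto simp: braid_group_def)
  ultimately show ?thesis by simp
qed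

lemma johnson_one:
  assumes "p \<in> {1..m}"
  shows "johnson m \<one>\<^bsub>AutoGroup F\<^esub> (X_gen m p) = \<one>\<^bsub>T2\<^esub>"
  using assms Aut.one_closed by (intro johnson_gen_fixed[OF _ assms assms]) (simp_all add: Aut_one)

text \<open>Membership in \<open>auto F\<close> is carried through the induction because
  \<open>johnson_mult\<close> needs the rest of the word to act by an automorphism.\<close>

lemma artin_rep_word:
  assumes "w \<in> words {1..<m}"
  shows "artin_rep m (pres_class {1..<m} (braid_relations m) w) \<in> auto F \<and>
    (\<forall>i\<in>{1..m}. johnson m (artin_rep m (pres_class {1..<m} (braid_relations m) w)) (X_gen m i) =
      wedge H (X_gen m i) (f_vec m i (crossing_matrix_of_diagram w)))"
  using assms
proof (induction w)
  case Nil
  then show ?case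
    using Aut.one_closed
    by (simp add: artin_rep_Nil johnson_one f_vec_zero H.wedge_one_right del: One_nat_def)
next
  case (Cons x w)
  obtain k e where x: "x = (k, e)" by fastforce
  have k: "k \<in> {1..<m}" and w: "w \<in> words {1..<m}" using Cons.prems x by auto
  let ?\<phi> = "artin_letter k e" and ?\<psi> = "artin_rep m (pres_class {1..<m} (braid_relations m) w)"
  let ?t = "transpose k (k + 1)"
  have \<psi>: "?\<psi> \<in> auto F" using Cons.IH[OF w] by blast
  have \<phi>: "?\<phi> \<in> auto F" by (rule artin_letter_auto[OF k])
  note f = ab_map_hom[OF auto_hom[OF \<phi>]]
  have rep: "artin_rep m (pres_class {1..<m} (braid_relations m) (x # w)) = ?\<phi> \<otimes>\<^bsub>AutoGroup F\<^esub> ?\<psi>"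
    unfolding x by (rule artin_rep_Cons[OF k w])
  have "johnson m (?\<phi> \<otimes>\<^bsub>AutoGroup F\<^esub> ?\<psi>) (X_gen m i) =
      wedge H (X_gen m i) (f_vec m i (crossing_matrix_of_diagram (x # w)))" if i: "i \<in> {1..m}" for i
  proof -
    have ti: "?t i \<in> {1..m}" using i transpose_range[OF k] by blast
    \<comment> \<open>The cocycle identity uses only the class of the preimage of x_i, and
      conjugation is invisible there; so the induction hypothesis is applied at the transposed
      index.\<close>
    have "ab_class m ((inv\<^bsub>AutoGroup F\<^esub> ?\<phi>) (x_gen m i)) = X_gen m (?t i)"
      using artin_letter_x_gen(2)[OF k i] ab_class_artin_image[OF k i] by simp
    then have "johnson m (?\<phi> \<otimes>\<^bsub>AutoGroup F\<^esub> ?\<psi>) (X_gen m i) = johnson m ?\<phi> (X_gen m i) \<otimes>\<^bsub>T2\<^esub>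
        tensor_map H (ab_map m ?\<phi>) 2 (johnson m ?\<psi> (X_gen m (?t i)))"
      using johnson_mult[OF \<phi> \<psi> x_gen_closed[OF i]] by (simp add: X_gen_def)
    also have "johnson m ?\<psi> (X_gen m (?t i)) =
        wedge H (X_gen m (?t i)) (f_vec m (?t i) (crossing_matrix_of_diagram w))"
      using Cons.IH[OF w] ti by blast
    \<comment> \<open>The automorphism |\<phi>| returns the first slot to X_i, while
      \<open>hom_f_vec\<close> transposes both indices of the matrix in the second slot. The common
      first slot then lets the two wedges be added.\<close>
    also have "tensor_map H (ab_map m ?\<phi>) 2 \<dots> = wedge H (X_gen m i)
        (f_vec m i (\<lambda>a b. crossing_matrix_of_diagram w (?t a) (?t b)))"
      using H.tensor_map_wedge[OF f X_gen_closed[OF ti] f_vec_closed]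
        hom_f_vec[OF k f ab_map_artin_letter[OF k]] ab_map_artin_letter[OF k ti] by simp
    also have "johnson m ?\<phi> (X_gen m i) = wedge H (X_gen m i) (f_vec m i (letter_crossing k e))"
      by (rule johnson_artin_letter[OF k i])
    also have "\<dots> \<otimes>\<^bsub>T2\<^esub> wedge H (X_gen m i)
        (f_vec m i (\<lambda>a b. crossing_matrix_of_diagram w (?t a) (?t b))) =
      wedge H (X_gen m i) (f_vec m i (\<lambda>a b. letter_crossing k e a b +
        crossing_matrix_of_diagram w (?t a) (?t b)))"
      using i by (simp add: f_vec_add H.wedge_mult_right)
    also have "(\<lambda>a b. letter_crossing k e a b + crossing_matrix_of_diagram w (?t a) (?t b)) =
        crossing_matrix_of_diagram (x # w)"
      by (simp add: fun_eq_iff x crossing_matrix_of_diagram_Cons)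
    finally show ?thesis .
  qed
  then show ?case
    unfolding rep using Aut.m_closed[of ?\<phi> ?\<psi>] \<phi> \<psi> by simp
qed

section \<open>Values in the exterior square and comparison with \<open>delta\<close>\<close>

lemma carrier_ext_square:
  "carrier (ext_square H) = generate T2 {wedge H a b | a b. a \<in> carrier H \<and> b \<in> carrier H}"
  by (simp add: ext_square_def)

lemma ext_square_subgroup: "subgroup (carrier (ext_square H)) T2"
  unfolding carrier_ext_square by (rule T2.generate_is_subgroup) auto

text \<open>The exterior square is a subgroup of \<open>T2\<close>, so membership spreads from the
  generators to all of \<open>H\<close>. The induction runs over \<open>F\<close>, whose elements
  represent all classes.\<close>

lemma johnson_Hom:
  assumes \<phi>: "\<phi> \<in> auto F"
    and gen: "\<And>i. i \<in> {1..m} \<Longrightarrow> johnson m \<phi> (X_gen m i) \<in> carrier (ext_square H)"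
  shows "johnson m \<phi> \<in> Hom H (ext_square H)"
proof -
  interpret E: subgroup "carrier (ext_square H)" T2 by (rule ext_square_subgroup)
  note J = johnson_hom[OF \<phi>]
  let ?j = "\<lambda>x. johnson m \<phi> (ab_class m x)"
  interpret j: group_hom F T2 ?j
    using hom_compose[OF ab_class_hom J] by (simp add: group_hom_def group_hom_axioms_def o_def)
  have "?j x \<in> carrier (ext_square H)" if "x \<in> carrier F" for x
    using that unfolding free_group_def
  proof (induction rule: presented_group_induct)
    case one
    then show ?case using j.hom_one E.one_closed by (simp only: free_group_def)
  next
    case (gen g y)
    then have "x_gen m g \<in> carrier F" "y \<in> carrier F" "?j (x_gen m g) \<in> carrier (ext_square H)"
      using x_gen_closed assms(2) by (simp_all only: free_group_def X_gen_def)
    then have "?j (x_gen m g \<otimes>\<^bsub>F\<^esub> y) \<in> carrier (ext_square H)"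
      using gen(3) by (simp only: j.hom_mult E.m_closed)
    then show ?case by (simp only: free_group_def x_gen_def)
  next
    case (inv g y)
    then have "x_gen m g \<in> carrier F" "y \<in> carrier F" "?j (x_gen m g) \<in> carrier (ext_square H)"
      using x_gen_closed assms(2) by (simp_all only: free_group_def X_gen_def)
    then have "?j (inv\<^bsub>F\<^esub> x_gen m g \<otimes>\<^bsub>F\<^esub> y) \<in> carrier (ext_square H)"
      using inv(3) by (simp only: j.hom_mult j.hom_inv E.m_closed E.m_inv_closed F.inv_closed)
    then show ?case by (simp only: free_group_def x_gen_def)
  qed
  then have "johnson m \<phi> h \<in> carrier (ext_square H)" if "h \<in> carrier H" for h
    using that by (auto simp: carrier_H)
  then have "johnson m \<phi> \<in> hom H (ext_square H)"
    using hom_mult[OF J] by (intro homI) (simp_all add: ext_square_def)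
  then show ?thesis using johnson_extensional by (simp add: Hom_def)
qed

lemma ext_square_hom: "h \<in> Hom H (ext_square H) \<Longrightarrow> h \<in> hom H T2"
proof -
  have "generate T2 {wedge H a b | a b. a \<in> carrier H \<and> b \<in> carrier H} \<subseteq> carrier T2"
    using subgroup.subset[OF ext_square_subgroup] by (simp add: carrier_ext_square)
  moreover assume "h \<in> Hom H (ext_square H)"
  ultimately show ?thesis by (auto simp: Hom_def hom_def ext_square_def Pi_iff)
qed

text \<open>The given \<open>h\<close> supplies existence for the description in
  \<open>delta\<close>; uniqueness follows since homomorphisms on \<open>H\<close> are determined by
  the X_i.\<close>

lemma delta_eqI:
  assumes "M \<in> Mat0 m" "h \<in> Hom H (ext_square H)"
    "\<And>i. i \<in> {1..m} \<Longrightarrow> h (X_gen m i) = wedge H (X_gen m i) (f_vec m i M)"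
  shows "delta m M = h"
proof -
  have "h' = h" if h': "h' \<in> Hom H (ext_square H)"
    "\<forall>i\<in>{1..m}. h' (X_gen m i) = wedge H (X_gen m i) (f_vec m i M)" for h'
  proof (rule extensionalityI)
    show "h' \<in> extensional (carrier H)" "h \<in> extensional (carrier H)"
      using h' assms(2) by (simp_all add: Hom_def)
    show "h' x = h x" if "x \<in> carrier H" for x
      using H_hom_eq[OF T2.comm_group_axioms ext_square_hom[OF h'(1)] ext_square_hom[OF assms(2)] _ that]
        h'(2) assms(3) by simp
  qed
  then show ?thesis unfolding delta_def using assms by (simp only: restrict_apply if_True, intro the_equality) blast+
qed

end

theorem theorem4p2:
  fixes m :: nat
  assumes "m \<ge> 2"
  shows "\<forall>\<beta>\<in>carrier (braid_group m).
      johnson m (artin_rep m \<beta>) \<in> Hom (H_ab m) (ext_square (H_ab m)) \<and>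
      johnson m (artin_rep m \<beta>) = delta m (crossing_matrix \<beta>) \<and>
      (\<forall>i\<in>{1..m}. johnson m (artin_rep m \<beta>) (X_gen m i) =
         wedge (H_ab m) (X_gen m i) (f_vec m i (crossing_matrix \<beta>)))"
proof
  interpret free_group_rank m .
  fix \<beta> assume "\<beta> \<in> carrier (braid_group m)"
  then obtain w where w: "w \<in> words {1..<m}" "\<beta> = pres_class {1..<m} (braid_relations m) w"
    by (auto simp: braid_group_def carrier_presented_group)
  have C: "crossing_matrix \<beta> = crossing_matrix_of_diagram w"
    unfolding w(2) by (rule crossing_matrix_pres_class[OF w(1)])
  have \<phi>: "artin_rep m \<beta> \<in> auto F"
    and J: "\<forall>i\<in>{1..m}. johnson m (artin_rep m \<beta>) (X_gen m i) = wedge H (X_gen m i) (f_vec m i (crossing_matrix \<beta>))"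
    using artin_rep_word[OF w(1)] unfolding C unfolding w(2) by blast+
  have Hom: "johnson m (artin_rep m \<beta>) \<in> Hom H (ext_square H)"
  proof (rule johnson_Hom[OF \<phi>])
    fix i assume i: "i \<in> {1..m}"
    have "wedge H (X_gen m i) (f_vec m i (crossing_matrix \<beta>)) \<in> carrier (ext_square H)"
      unfolding carrier_ext_square using X_gen_closed[OF i] f_vec_closed by (intro generate.incl) blast
    then show "johnson m (artin_rep m \<beta>) (X_gen m i) \<in> carrier (ext_square H)" using J i by simp
  qed
  have "crossing_matrix \<beta> \<in> Mat0 m"
    unfolding C by (rule crossing_matrix_of_diagram_Mat0[OF w(1)])
  \<comment> \<open>The Johnson homomorphism is itself the candidate \<open>h\<close>: its values on
    the X_i are the prescribed wedges.\<close>
  then have "delta m (crossing_matrix \<beta>) = johnson m (artin_rep m \<beta>)"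
    using Hom J by (intro delta_eqI) blast+
  then show "johnson m (artin_rep m \<beta>) \<in> Hom H (ext_square H) \<and>
      johnson m (artin_rep m \<beta>) = delta m (crossing_matrix \<beta>) \<and>
      (\<forall>i\<in>{1..m}. johnson m (artin_rep m \<beta>) (X_gen m i) =
         wedge H (X_gen m i) (f_vec m i (crossing_matrix \<beta>)))"
    using Hom J by simp
qed

end
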